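(* Let $\{\omega^t\}_{t\in[0,1]}$ be a family of doubling weights on $\mathbb{T}$ with doubling constants at most $C_{\rm dbl}$ for all $t$, and suppose $(t,x)\mapsto\omega^t(x)$ is measurable. (1) Fix $1\le p\le\infty$ and suppose $\omega^t\in A_p^d$ with $A_p^d(\omega^t)\le V_{p,d}$ for all $t$. Then the translation-average $\omega(x)=\int_0^1\omega^t(x+t)\,dt$ belongs to $A_p(\mathbb{T})$, with $A_p(\omega)$ bounded by a constant depending only on $p$, $V_{p,d}$ and $C_{\rm dbl}$. (2) Fix $1<p\le\infty$ and suppose $\omega^t\in RH_p^d$ with $RH_p^d(\omega^t)\le V_{p,d}$ for all $t$. Then $\omega\in RH_p(\mathbb{T})$ with $RH_p(\omega)$ bounded by a constant depending only on $p$, $V_{p,d}$ and $C_{\rm dbl}$.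
   Context: $\mathbb{T}$ is the circle $[0,1]$ with endpoints identified; $x+t$ taken mod 1. A weight is a nonnegative locally integrable function. $\omega$ is doubling with constant $C$ if $\int_{\widetilde Q}\omega\le C\int_Q\omega$ for every interval $Q\subset\mathbb{T}$, $\widetilde Q$ being the interval with the same midpoint and twice the length. Dyadic intervals $\mathcal{D}=\{[0,1]\}\cup\{[j2^{-k},(j+1)2^{-k})\}$; $-\!\!\!\!\!\!\int_E f=\frac1{|E|}\int_E f$. $A_p(\omega)$: for $1<p<\infty$, $\sup_Q(-\!\!\!\!\!\!\int_Q\omega)(-\!\!\!\!\!\!\int_Q\omega^{-1/(p-1)})^{p-1}$; $A_1(\omega)=\sup_Q(-\!\!\!\!\!\!\int_Q\omega)/\operatorname{ess\,inf}_Q\omega$; $A_\infty(\omega)=\sup_Q(-\!\!\!\!\!\!\int_Q\omega)\exp(-\!\!\!\!\!\!\int_Q\log(1/\omega))$. $RH_p(\omega)=\sup_Q(-\!\!\!\!\!\!\int_Q\omega^p)^{1/p}(-\!\!\!\!\!\!\int_Q\omega)^{-1}$ for $1<p<\infty$, $RH_\infty(\omega)=\sup_Q(\operatorname{ess\,sup}_Q\omega)(-\!\!\!\!\!\!\int_Q\omega)^{-1}$. Suprema are over all intervals $Q\subset\mathbb{T}$; the dyadic versions $A_p^d$, $A_p^d(\omega)$ take suprema over $I\in\mathcal{D}$ only; $RH_p^d$ additionally requires dyadic doubling ($\int_{\widetilde I}\omega\le C\int_I\omega$, $\widetilde I$ the dyadic interval of length $2|I|$ containing $I$), and $RH_p^d(\omega)$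 is the larger of the dyadic supremum and the dyadic doubling constant.
   Formalization: Adds the hypothesis that the translation-average ω is integrable over the circle (otherwise false: ω^t = 1/t gives ω = ∞, not a weight); "measurable" is taken as Borel measurable in (t,x). *)

theory Defs
  imports "HOL-Analysis.Analysis"
begin

text \<open>The circle T is modelled by 1-periodic functions on the reals.
  An interval (arc) Q of T is a set {a..a+l} with 0 < l \<le> 1.
  All constants are computed in ennreal, so that infinite averages are allowed.\<close>

definition weight :: "(real \<Rightarrow> real) \<Rightarrow> bool" where
  "weight w \<longleftrightarrow> (\<forall>x. 0 \<le> w x) \<and> (\<forall>x. w (x + 1) = w x) \<and> set_integrable lborel {0..1} w"

definition arcs :: "real set set" where
  "arcs = {{a..a+l} | a l. 0 < l \<and> l \<le> 1}"

definition double_arc :: "real \<Rightarrow> real \<Rightarrow> real set" where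
  "double_arc a l = (let d = (min (2*l) 1 - l) / 2 in {a - d .. a + l + d})"

definition doubling :: "real \<Rightarrow> (real \<Rightarrow> real) \<Rightarrow> bool" where
  "doubling C w \<longleftrightarrow> (\<forall>a l. 0 < l \<and> l \<le> 1 \<longrightarrow>
     (\<integral>\<^sup>+x\<in>double_arc a l. ennreal (w x) \<partial>lborel)
       \<le> ennreal C * (\<integral>\<^sup>+x\<in>{a..a+l}. ennreal (w x) \<partial>lborel))"

definition dyadic_ivl :: "nat \<Rightarrow> nat \<Rightarrow> real set" where
  "dyadic_ivl k j = {real j / 2^k ..< (real j + 1) / 2^k}"

definition dyadics :: "real set set" where
  "dyadics = insert {0..1} {dyadic_ivl k j | k j. j < 2^k}"

text \<open>Dyadic doubling: the parent dyadic interval (length 2|I|) containing I.\<close>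
definition dyadic_doubling :: "real \<Rightarrow> (real \<Rightarrow> real) \<Rightarrow> bool" where
  "dyadic_doubling C w \<longleftrightarrow> (\<forall>k j. 0 < k \<and> j < 2^k \<longrightarrow>
     (\<integral>\<^sup>+x\<in>dyadic_ivl (k - 1) (j div 2). ennreal (w x) \<partial>lborel)
       \<le> ennreal C * (\<integral>\<^sup>+x\<in>dyadic_ivl k j. ennreal (w x) \<partial>lborel))"

definition avg :: "real set \<Rightarrow> (real \<Rightarrow> ennreal) \<Rightarrow> ennreal" where
  "avg Q f = (\<integral>\<^sup>+x\<in>Q. f x \<partial>lborel) / ennreal (measure lborel Q)"

text \<open>Real power (exponent r > 0) of an extended nonnegative real; top stays top.\<close>
definition epowr :: "ennreal \<Rightarrow> real \<Rightarrow> ennreal" where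
  "epowr a r = (if a = \<infinity> then \<infinity> else ennreal (enn2real a powr r))"

definition ess_sup_on :: "real set \<Rightarrow> (real \<Rightarrow> real) \<Rightarrow> ennreal" where
  "ess_sup_on Q w = Inf {c. AE x in lborel. x \<in> Q \<longrightarrow> ennreal (w x) \<le> c}"

definition ess_inf_on :: "real set \<Rightarrow> (real \<Rightarrow> real) \<Rightarrow> ennreal" where
  "ess_inf_on Q w = Sup {c. AE x in lborel. x \<in> Q \<longrightarrow> c \<le> ennreal (w x)}"

definition exp_avg_log_inv :: "real set \<Rightarrow> (real \<Rightarrow> real) \<Rightarrow> ennreal" where
  "exp_avg_log_inv Q w =
    (let P = (\<integral>\<^sup>+x\<in>Q. (if 0 < w x then ennreal (max 0 (- ln (w x))) else \<infinity>) \<partial>lborel);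
         N = (\<integral>\<^sup>+x\<in>Q. ennreal (if 0 < w x then max 0 (ln (w x)) else 0) \<partial>lborel)
     in if P = \<infinity> then \<infinity> else if N = \<infinity> then 0
        else ennreal (exp ((enn2real P - enn2real N) / measure lborel Q)))"

definition dual_pow :: "real \<Rightarrow> (real \<Rightarrow> real) \<Rightarrow> real \<Rightarrow> ennreal" where
  "dual_pow p w x = (if w x = 0 then \<infinity> else ennreal (w x powr (- 1 / (p - 1))))"

definition Ap_on :: "ereal \<Rightarrow> (real \<Rightarrow> real) \<Rightarrow> real set \<Rightarrow> ennreal" where
  "Ap_on p w Q =
    (if p = 1 then avg Q (\<lambda>x. ennreal (w x)) / ess_inf_on Q w
     else if p = \<infinity> then avg Q (\<lambda>x. ennreal (w x)) * exp_avg_log_inv Q w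
     else avg Q (\<lambda>x. ennreal (w x)) * epowr (avg Q (dual_pow (real_of_ereal p) w)) (real_of_ereal p - 1))"

definition RH_on :: "ereal \<Rightarrow> (real \<Rightarrow> real) \<Rightarrow> real set \<Rightarrow> ennreal" where
  "RH_on p w Q =
    (if p = \<infinity> then ess_sup_on Q w / avg Q (\<lambda>x. ennreal (w x))
     else epowr (avg Q (\<lambda>x. ennreal (w x powr real_of_ereal p))) (1 / real_of_ereal p)
            / avg Q (\<lambda>x. ennreal (w x)))"

definition Ap_const :: "ereal \<Rightarrow> (real \<Rightarrow> real) \<Rightarrow> ennreal" where
  "Ap_const p w = (SUP Q\<in>arcs. Ap_on p w Q)"

definition Apd_const :: "ereal \<Rightarrow> (real \<Rightarrow> real) \<Rightarrow> ennreal" where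
  "Apd_const p w = (SUP I\<in>dyadics. Ap_on p w I)"

definition RH_const :: "ereal \<Rightarrow> (real \<Rightarrow> real) \<Rightarrow> ennreal" where
  "RH_const p w = (SUP Q\<in>arcs. RH_on p w Q)"

definition RHd_le :: "ereal \<Rightarrow> (real \<Rightarrow> real) \<Rightarrow> real \<Rightarrow> bool" where
  "RHd_le p w V \<longleftrightarrow> (SUP I\<in>dyadics. RH_on p w I) \<le> ennreal V \<and> dyadic_doubling V w"

definition trans_avg :: "(real \<Rightarrow> real \<Rightarrow> real) \<Rightarrow> real \<Rightarrow> real" where
  "trans_avg om x = (\<integral>t\<in>{0..1}. om t (x + t) \<partial>lborel)"

end

theory Submission
  imports Defs
begin

text \<open>
  After normalizing a weight by its mean on \<^term>\<open>Q\<close>, every one of the conditions says that the mean over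
  \<^term>\<open>Q\<close> of \<open>\<Phi> (w / avg w)\<close> is bounded for a suitable convex \<open>\<Phi>\<close>: \<open>u powr (- 1 / (p - 1))\<close> for \<open>A_p\<close>,
  \<open>u - ln u - 1\<close> for \<open>A_\<infinity>\<close>, \<open>u powr p\<close> for \<open>RH_p\<close>, and the functions with values \<open>0\<close> and \<open>\<infinity>\<close> that force
  \<open>u \<ge> k\<close> or \<open>u \<le> k\<close> for \<open>A_1\<close> and \<open>RH_\<infinity>\<close>. An arc is covered by two dyadic intervals of comparable length,
  and doubling makes the three masses comparable, so the dyadic bounds extend to all arcs and thus become
  translation invariant. Finally, if \<open>a t\<close> is the mean over \<^term>\<open>Q\<close> of the translate \<open>f t\<close> of the \<open>t\<close>-th weight and
  \<open>A = \<integral> a t dt\<close>, then the normalized average is the convex combination \<open>\<integral> (f t / a t) (a t / A) dt\<close> of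
  the normalized translates, and Jensen's inequality followed by Fubini's theorem preserves the bound.
\<close>

section \<open>Periodic functions and doubling\<close>

lemma set_nn_integral_shift:
  fixes f :: "real \<Rightarrow> ennreal"
  assumes [measurable]: "f \<in> borel_measurable borel" "A \<in> sets borel"
  shows "(\<integral>\<^sup>+x\<in>A. f x \<partial>lborel) = (\<integral>\<^sup>+x. f (x + t) * indicator A (x + t) \<partial>lborel)"
  using nn_integral_real_affine[of "\<lambda>x. f x * indicator A x" 1 t] by (simp add: add.commute)

lemma periodic_of_int:
  fixes f :: "real \<Rightarrow> 'a"
  assumes "\<And>x. f (x + 1) = f x"
  shows "f (x + of_int n) = f x"
proof -
  have nat: "f (x + real k) = f x" for k x
  proof (induction k)
    case (Suc k)
    then show ?case using assms[of "x + real k"] by (simp add: add_ac)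
  qed simp
  show ?thesis
  proof (cases n)
    case (nonneg k)
    then show ?thesis using nat[of x k] by simp
  next
    case (neg k)
    then show ?thesis using nat[of "x + of_int n" "Suc k"] by simp
  qed
qed

lemma set_nn_integral_closed_eq_halfopen:
  fixes f :: "real \<Rightarrow> ennreal"
  shows "(\<integral>\<^sup>+x\<in>{a..b}. f x \<partial>lborel) = (\<integral>\<^sup>+x\<in>{a..<b}. f x \<partial>lborel)"
proof (rule nn_integral_cong_AE)
  show "AE x in lborel. f x * indicator {a..b} x = f x * indicator {a..<b} x"
    using AE_lborel_singleton[of b] by eventually_elim (auto split: split_indicator)
qed

lemma set_nn_integral_periodic_int_shift:
  fixes f :: "real \<Rightarrow> ennreal"
  assumes "f \<in> borel_measurable borel" "\<And>x. f (x + 1) = f x"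
  shows "(\<integral>\<^sup>+x\<in>{a + of_int n..<b + of_int n}. f x \<partial>lborel) = (\<integral>\<^sup>+x\<in>{a..<b}. f x \<partial>lborel)"
proof -
  have "(\<integral>\<^sup>+x\<in>{a + of_int n..<b + of_int n}. f x \<partial>lborel)
     = (\<integral>\<^sup>+x. f (x + of_int n) * indicator {a + of_int n..<b + of_int n} (x + of_int n) \<partial>lborel)"
    by (rule set_nn_integral_shift) (use assms in auto)
  also have "\<dots> = (\<integral>\<^sup>+x\<in>{a..<b}. f x \<partial>lborel)"
    by (intro nn_integral_cong) (simp add: periodic_of_int[of f, OF assms(2)] split: split_indicator)
  finally show ?thesis .
qed

text \<open>An integer shift moves the left endpoint to \<open>frac a\<close>; the part of the
  period beyond 1 is then carried back by one period and fills the gap at 0.\<close>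

lemma set_nn_integral_periodic_full:
  fixes f :: "real \<Rightarrow> ennreal"
  assumes [measurable]: "f \<in> borel_measurable borel" and per: "\<And>x. f (x + 1) = f x"
  shows "(\<integral>\<^sup>+x\<in>{a..a+1}. f x \<partial>lborel) = (\<integral>\<^sup>+x\<in>{0..1}. f x \<partial>lborel)"
proof -
  define b where "b = frac a"
  have b: "0 \<le> b" "b < 1" "a = b + of_int \<lfloor>a\<rfloor>" using frac_lt_1[of a] by (auto simp: b_def) (simp add: frac_def)
  have "(\<integral>\<^sup>+x\<in>{a..<a+1}. f x \<partial>lborel) = (\<integral>\<^sup>+x\<in>{b..<b+1}. f x \<partial>lborel)"
    using set_nn_integral_periodic_int_shift[OF assms, of b "\<lfloor>a\<rfloor>" "b+1"] b(3)
    by (simp add: add_ac)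
  also have "\<dots> = (\<integral>\<^sup>+x. f x * indicator {b..<1} x + f x * indicator {1..<b+1} x \<partial>lborel)"
    using b by (intro nn_integral_cong) (auto split: split_indicator)
  also have "\<dots> = (\<integral>\<^sup>+x\<in>{b..<1}. f x \<partial>lborel) + (\<integral>\<^sup>+x\<in>{1..<b+1}. f x \<partial>lborel)"
    by (rule nn_integral_add) auto
  also have "(\<integral>\<^sup>+x\<in>{1..<b+1}. f x \<partial>lborel) = (\<integral>\<^sup>+x\<in>{0..<b}. f x \<partial>lborel)"
    using set_nn_integral_periodic_int_shift[OF assms, of 0 1 b] by simp
  also have "(\<integral>\<^sup>+x\<in>{b..<1}. f x \<partial>lborel) + (\<integral>\<^sup>+x\<in>{0..<b}. f x \<partial>lborel)
      = (\<integral>\<^sup>+x. f x * indicator {b..<1} x + f x * indicator {0..<b} x \<partial>lborel)"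
    by (rule nn_integral_add[symmetric]) auto
  also have "\<dots> = (\<integral>\<^sup>+x\<in>{0..<1}. f x \<partial>lborel)"
    using b by (intro nn_integral_cong) (auto split: split_indicator)
  finally show ?thesis by (simp add: set_nn_integral_closed_eq_halfopen)
qed

lemma set_nn_integral_periodic_le_full:
  fixes f :: "real \<Rightarrow> ennreal"
  assumes "f \<in> borel_measurable borel" "\<And>x. f (x + 1) = f x" "b \<le> a + 1"
  shows "(\<integral>\<^sup>+x\<in>{a..b}. f x \<partial>lborel) \<le> (\<integral>\<^sup>+x\<in>{0..1}. f x \<partial>lborel)"
proof -
  have "(\<integral>\<^sup>+x\<in>{a..b}. f x \<partial>lborel) \<le> (\<integral>\<^sup>+x\<in>{a..a+1}. f x \<partial>lborel)"
    using assms(3) by (intro nn_integral_mono) (auto split: split_indicator)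
  then show ?thesis using set_nn_integral_periodic_full[OF assms(1,2)] by simp
qed

lemma doubling_mono: "doubling C w \<Longrightarrow> C \<le> C' \<Longrightarrow> doubling C' w"
  unfolding doubling_def
  by (meson dual_order.trans ennreal_leI mult_right_mono zero_le)

text \<open>Three concentric doublings enlarge the half-length \<open>l/2\<close> to
  \<open>4*l\<close>, and \<open>near\<close> places the second interval inside the enlarged one.
  The enlarged arc may exhaust the whole circle; periodicity covers that case.\<close>

lemma doubling_arcs_comparable:
  assumes [measurable]: "w \<in> borel_measurable borel" and w: "weight w" and dbl: "doubling C w" and C: "1 \<le> C"
    and l: "0 < l" "l \<le> 1" and l': "l' \<le> 1"
    and near: "a + l/2 - 4*l \<le> a'" "a' + l' \<le> a + l/2 + 4*l"
  shows "(\<integral>\<^sup>+x\<in>{a'..a'+l'}. ennreal (w x) \<partial>lborel)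
    \<le> ennreal (C^3) * (\<integral>\<^sup>+x\<in>{a..a+l}. ennreal (w x) \<partial>lborel)"
proof -
  define c where "c = a + l/2"
  \<comment> \<open>Radii are capped at 1/2 just as \<open>double_arc\<close> caps lengths at 1, so
    \<open>M\<close> becomes constant once the arc is the full circle.\<close>
  define M where "M r = (\<integral>\<^sup>+x\<in>{c - min r (1/2)..c + min r (1/2)}. ennreal (w x) \<partial>lborel)" for r
  have per: "ennreal (w (x + 1)) = ennreal (w x)" for x using w by (simp add: weight_def)
  have step: "M (2*r) \<le> ennreal C * M r" if "0 < r" for r
  proof (cases "r \<le> 1/2")
    case True
    have "double_arc (c - r) (2*r) = {c - min (2*r) (1/2)..c + min (2*r) (1/2)}"
      by (auto simp: double_arc_def Let_def min_def field_simps)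
    moreover have "{c - r..c - r + 2*r} = {c - min r (1/2)..c + min r (1/2)}"
      using True by (simp add: min_def)
    ultimately show ?thesis
      using dbl[unfolded doubling_def, rule_format, of "2*r" "c - r"] that True
      unfolding M_def by (simp only:) simp
  next
    case False
    then have "M (2*r) = M r" by (simp add: M_def min_def)
    then show ?thesis using C mult_right_mono[of 1 "ennreal C" "M r"] by simp
  qed
  have "M (2*(2*(2*(l/2)))) \<le> ennreal C * (ennreal C * (ennreal C * M (l/2)))"
    using l by (intro order.trans[OF step] mult_left_mono) auto
  also have "\<dots> = ennreal (C^3) * M (l/2)"
    using C by (simp add: power3_eq_cube ennreal_mult mult.assoc)
  also have "M (l/2) = (\<integral>\<^sup>+x\<in>{a..a+l}. ennreal (w x) \<partial>lborel)"
    using l by (simp add: M_def c_def min_def add.commute)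
  finally have M: "M (4*l) \<le> ennreal (C^3) * (\<integral>\<^sup>+x\<in>{a..a+l}. ennreal (w x) \<partial>lborel)" by simp
  have "(\<integral>\<^sup>+x\<in>{a'..a'+l'}. ennreal (w x) \<partial>lborel) \<le> M (4*l)"
  proof (cases "4*l \<le> 1/2")
    case True
    then show ?thesis unfolding M_def using near
      by (intro nn_integral_mono) (auto simp: c_def split: split_indicator)
  next
    case False
    \<comment> \<open>With the cap active, \<open>M (4*l)\<close> is the integral over a full
      period, which dominates that over any arc of length at most 1, wherever it lies.\<close>
    then have "M (4*l) = (\<integral>\<^sup>+x\<in>{c - 1/2..(c - 1/2) + 1}. ennreal (w x) \<partial>lborel)"
      by (simp add: M_def add.commute)
    also have "\<dots> = (\<integral>\<^sup>+x\<in>{0..1}. ennreal (w x) \<partial>lborel)"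
      by (rule set_nn_integral_periodic_full) (use per in auto)
    finally show ?thesis
      using set_nn_integral_periodic_le_full[of "\<lambda>x. ennreal (w x)" "a'+l'" a'] per l' by simp
  qed
  then show ?thesis using M by (rule order.trans)
qed

lemma weight_set_nn_integral_finite:
  assumes [measurable]: "w \<in> borel_measurable borel" and w: "weight w" and "b \<le> a + 1"
  shows "(\<integral>\<^sup>+x\<in>{a..b}. ennreal (w x) \<partial>lborel) < \<infinity>"
proof -
  have "(\<integral>\<^sup>+x\<in>{a..b}. ennreal (w x) \<partial>lborel) \<le> (\<integral>\<^sup>+x\<in>{0..1}. ennreal (w x) \<partial>lborel)"
    using assms by (intro set_nn_integral_periodic_le_full) (auto simp: weight_def)
  also have "\<dots> = (\<integral>\<^sup>+x. ennreal (norm (indicator {0..1} x *\<^sub>R w x)) \<partial>lborel)"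
    using w by (intro nn_integral_cong) (auto simp: weight_def split: split_indicator)
  also have "\<dots> < \<infinity>"
    using w by (auto simp: weight_def set_integrable_def integrable_iff_bounded simp del: real_norm_def)
  finally show ?thesis .
qed

section \<open>From dyadic intervals to arcs\<close>

text \<open>A zero mean cannot be normalized, so the condition is then void; that case is settled
  separately whenever a bound on an original functional is recovered.\<close>

definition normalized_mean_le :: "(real \<Rightarrow> ennreal) \<Rightarrow> real \<Rightarrow> (real \<Rightarrow> real) \<Rightarrow> real set \<Rightarrow> bool" where
  "normalized_mean_le \<Phi> M w Q \<longleftrightarrow>
    (avg Q (\<lambda>x. ennreal (w x)) \<noteq> 0 \<longrightarrow>
     avg Q (\<lambda>x. \<Phi> (w x / enn2real (avg Q (\<lambda>x. ennreal (w x))))) \<le> ennreal M)"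

text \<open>Take the last \<open>k\<close> for which \<open>1 / 2^k\<close> is still at least
  \<open>l\<close>: one more halving drops below \<open>l\<close>, which is the second
  inequality.\<close>

lemma dyadic_scale_exists:
  assumes "0 < l" "l \<le> (1::real)"
  obtains k :: nat where "l \<le> 1 / 2^k" "1 / 2^k < 2 * l"
proof -
  obtain n where n: "(1/2)^n < l" using real_arch_pow_inv[of l "1/2"] assms by auto
  define m where "m = (LEAST n. (1/2)^n < l)"
  have m: "(1/2)^m < l" unfolding m_def by (rule LeastI[of _ n]) (rule n)
  have "m \<noteq> 0" using m assms by (intro notI) simp
  then obtain k where k: "m = Suc k" using not0_implies_Suc by blast
  have "\<not> (1/2)^k < l" using not_less_Least[of k "\<lambda>n. (1/2)^n < l"] k by (auto simp: m_def)
  then show thesis using m k by (intro that[of k]) (simp_all add: power_divide)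
qed

lemma avg_le_iff:
  assumes "0 < measure lborel Q"
  shows "avg Q f \<le> ennreal M \<longleftrightarrow> (\<integral>\<^sup>+x\<in>Q. f x \<partial>lborel) \<le> ennreal M * ennreal (measure lborel Q)"
proof -
  let ?X = "\<integral>\<^sup>+x\<in>Q. f x \<partial>lborel" and ?q = "ennreal (measure lborel Q)"
  have q: "0 < ?q" using assms by simp
  have X: "?X / ?q * ?q = ?X"
    using q by (subst ennreal_divide_times) (simp add: ennreal_divide_self)
  show ?thesis unfolding avg_def
  proof
    assume "?X / ?q \<le> ennreal M"
    then have "?X / ?q * ?q \<le> ennreal M * ?q" by (rule mult_right_mono) simp
    then show "?X \<le> ennreal M * ?q" by (simp only: X)
  qed (use q in \<open>simp add: divide_le_posI_ennreal mult.commute\<close>)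
qed

text \<open>Continues the dyadic grid periodically over the real line, so that a covering of an arc
  may cross an integer: by \<open>m = j + n * 2^k\<close>, cell \<open>m\<close> is cell
  \<open>j\<close> shifted by the integer \<open>n\<close>.\<close>

lemma avg_dyadic_translate:
  fixes f :: "real \<Rightarrow> ennreal" and m :: int and k :: nat
  assumes "f \<in> borel_measurable borel" "\<And>x. f (x + 1) = f x"
  shows "avg (dyadic_ivl k (nat (m mod 2^k))) f = avg {m / 2^k..<(m + 1) / 2^k} f"
proof -
  define j where "j = m mod 2^k"
  define n where "n = m div 2^k"
  have j: "0 \<le> j" by (simp add: j_def)
  have m: "m = j + n * 2^k" unfolding j_def n_def by (simp only: mod_div_mult_eq)
  have mr: "real_of_int m = real_of_int j + real_of_int n * 2^k" by (simp add: m)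
  have eq: "real_of_int m / 2^k = real_of_int j / 2^k + real_of_int n"
    "real_of_int (m + 1) / 2^k = real_of_int (j + 1) / 2^k + real_of_int n"
    by (simp_all add: mr field_simps)
  have d: "dyadic_ivl k (nat (m mod 2^k)) = {j / 2^k..<(j + 1) / 2^k}"
    using j by (simp add: dyadic_ivl_def j_def)
  show ?thesis
    unfolding avg_def d eq
    by (simp only: set_nn_integral_periodic_int_shift[OF assms])
       (simp add: divide_right_mono del: of_int_add)
qed

text \<open>The arc lies in two consecutive grid cells of length \<open>q\<close>, the first
  containing \<open>a\<close>. Passing from the mean over a cell to the mean over the arc rescales
  the argument by a factor that \<open>scale\<close> absorbs. Per cell the terms
  \<open>\<Phi> u\<close>, \<open>u\<close> and 1 contribute \<open>M + 2\<close>; two cells and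
  \<open>q < 2 * l\<close> produce the 4.\<close>

lemma normalized_mean_le_arc_of_dyadic:
  assumes [measurable]: "w \<in> borel_measurable borel" "\<Phi> \<in> borel_measurable borel" "\<Psi> \<in> borel_measurable borel"
    and w: "weight w" and dbl: "doubling C w" and C: "1 \<le> C"
    and dy: "\<And>k j. j < 2^k \<Longrightarrow> normalized_mean_le \<Phi> M w (dyadic_ivl k j)" and M: "0 \<le> M" and N: "0 \<le> N"
    and scale: "\<And>u s. 0 \<le> u \<Longrightarrow> 1 / (2 * C^3) \<le> s \<Longrightarrow> s \<le> 2 * C^3 \<Longrightarrow>
      \<Psi> (u * s) \<le> ennreal N * (\<Phi> u + ennreal u + 1)"
    and l: "0 < l" "l \<le> 1"
  shows "normalized_mean_le \<Psi> (4 * N * (M + 2)) w {a..a+l}"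
  unfolding normalized_mean_le_def
proof (intro impI)
  let ?m = "\<lambda>Q. (\<integral>\<^sup>+x\<in>Q. ennreal (w x) \<partial>lborel)"
  let ?A = "\<lambda>Q. avg Q (\<lambda>x. ennreal (w x))"
  define Q where "Q = {a..a+l}"
  assume pos: "?A {a..a+l} \<noteq> 0"
  obtain k :: nat where k: "l \<le> 1 / 2^k" "1 / 2^k < 2 * l" using dyadic_scale_exists[OF l] .
  define q :: real where "q = 1 / 2^k"
  have q: "0 < q" "q \<le> 1" "l \<le> q" "q < 2*l" using k by (auto simp: q_def)
  define m where "m = \<lfloor>a / q\<rfloor>"
  have fl: "real_of_int m \<le> a / q" "a / q < real_of_int m + 1" by (auto simp: m_def)
  have m1: "m * q \<le> a" using fl(1) q(1) by (simp add: pos_le_divide_eq)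
  have m2: "a < (m + 1) * q" using fl(2) q(1) by (simp add: pos_divide_less_eq)
  define mu where "mu = enn2real (?m Q)"
  have mQ: "?m Q = ennreal mu" using weight_set_nn_integral_finite[of w "a+l" a] w l
    by (simp add: mu_def Q_def less_top)
  have measQ: "measure lborel Q = l" using l by (simp add: Q_def)
  have mupos: "0 < mu"
  proof (rule ccontr)
    assume "\<not> 0 < mu"
    then have "?m Q = 0" using mQ by (simp add: ennreal_neg)
    then show False using pos by (simp add: avg_def Q_def)
  qed
  define \<alpha> where "\<alpha> = mu / l"
  have \<alpha>: "?A Q = ennreal \<alpha>" "0 < \<alpha>" using l mupos
    by (auto simp: avg_def mQ measQ \<alpha>_def divide_ennreal)
  have per: "w (x + 1) = w x" and w0: "0 \<le> w x" for x using w by (auto simp: weight_def)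
  have J: "(\<integral>\<^sup>+x\<in>{i * q..<(i + 1) * q}. \<Psi> (w x / \<alpha>) \<partial>lborel) \<le> ennreal (N * (M + 2) * q)"
    if i: "i = m \<or> i = m + 1" for i :: int
  proof -
    define J where "J = {i * q..<(i + 1) * q}"
    define J' where "J' = {i * q..i * q + q}"
    have mJ: "?m J = ?m J'"
      unfolding J_def J'_def set_nn_integral_closed_eq_halfopen by (simp add: algebra_simps)
    have i': "m * q \<le> i * q" "i * q \<le> m * q + q" using i q by (auto simp: algebra_simps)
    define nu where "nu = enn2real (?m J)"
    have mJn: "?m J = ennreal nu" using weight_set_nn_integral_finite[of w "i*q+q" "i*q"] w q
      by (simp add: nu_def mJ J'_def less_top)
    have C3: "0 < C^3" "0 \<le> C^3" using C by auto
    have m2': "a < m * q + q" using m2 by (simp add: algebra_simps)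
    \<comment> \<open>Doubling is used in both directions, from arc to cell and from cell to arc.
      Each lies within four lengths of the midpoint of the other because \<open>l \<le> q\<close>
      and \<open>q < 2 * l\<close>.\<close>
    have "?m J' \<le> ennreal (C^3) * ?m Q" unfolding J'_def Q_def
      by (rule doubling_arcs_comparable[OF assms(1) w dbl C l q(2)])
         (use l q m1 m2' i' in linarith)+
    then have "ennreal nu \<le> ennreal (C^3 * mu)"
      using C3 mupos by (simp only: mJ[symmetric] mJn mQ) (simp add: ennreal_mult)
    then have c1: "nu \<le> C^3 * mu" using C3 mupos by (simp add: ennreal_le_iff)
    have "?m Q \<le> ennreal (C^3) * ?m J'" unfolding J'_def Q_def
      by (rule doubling_arcs_comparable[OF assms(1) w dbl C q(1,2) l(2)])
         (use l q m1 m2' i' in linarith)+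
    then have c2': "ennreal mu \<le> ennreal (C^3 * nu)"
      using C3 by (simp only: mJ[symmetric] mJn mQ) (simp add: ennreal_mult')
    have nu: "0 < nu"
    proof (rule ccontr)
      assume "\<not> 0 < nu"
      then have "C^3 * nu \<le> 0" using C3 by (simp add: mult_nonneg_nonpos)
      then show False using c2' mupos by (simp add: ennreal_neg)
    qed
    then have c2: "mu \<le> C^3 * nu" using c2' C3 by (simp add: ennreal_le_iff)
    define \<beta> where "\<beta> = nu / q"
    have measJ: "measure lborel J = q" using q by (simp add: J_def algebra_simps)
    have \<beta>: "?A J = ennreal \<beta>" "0 < \<beta>" using q nu
      by (auto simp: avg_def mJn measJ \<beta>_def divide_ennreal)
    \<comment> \<open>The ratio of the means is the ratio of the masses, controlled by
      \<open>C^3\<close> both ways, times \<open>l / q\<close>, which lies between 1/2 and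
      1.\<close>
    define s where "s = \<beta> / \<alpha>"
    have s: "1 / (2 * C^3) \<le> s" "s \<le> 2 * C^3"
    proof -
      have "mu * q \<le> (C^3 * nu) * (2 * l)" using c2 q l mupos by (intro mult_mono) auto
      then show "1 / (2 * C^3) \<le> s"
        using q l nu mupos C3 by (simp add: s_def \<beta>_def \<alpha>_def field_simps)
      have "nu * l \<le> (C^3 * mu) * q" using c1 q l nu C3 by (intro mult_mono) auto
      also have "\<dots> \<le> 2 * (C^3 * mu * q)" using C3 mupos q by simp
      finally show "s \<le> 2 * C^3"
        using q l nu mupos C3 by (simp add: s_def \<beta>_def \<alpha>_def field_simps)
    qed
    have Jeq: "J = {i / 2^k..<(i + 1) / 2^k}" by (simp add: J_def q_def)
    have jlt: "nat (i mod 2^k) < 2^k"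
      by (simp add: nat_less_iff)
    have e1: "?A (dyadic_ivl k (nat (i mod 2^k))) = ?A J"
      unfolding Jeq by (rule avg_dyadic_translate) (use per in auto)
    have e2: "avg (dyadic_ivl k (nat (i mod 2^k))) (\<lambda>x. \<Phi> (w x / \<beta>)) = avg J (\<lambda>x. \<Phi> (w x / \<beta>))"
      unfolding Jeq by (rule avg_dyadic_translate) (use per in auto)
    have "avg J (\<lambda>x. \<Phi> (w x / \<beta>)) \<le> ennreal M"
      using dy[OF jlt] \<beta> unfolding normalized_mean_le_def e1 by (simp add: e2)
    then have PJ: "(\<integral>\<^sup>+x\<in>J. \<Phi> (w x / \<beta>) \<partial>lborel) \<le> ennreal M * ennreal q"
      using avg_le_iff[of J] measJ q by simp
    have "(\<integral>\<^sup>+x\<in>J. \<Psi> (w x / \<alpha>) \<partial>lborel)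
        \<le> (\<integral>\<^sup>+x. ennreal N * (\<Phi> (w x / \<beta>) * indicator J x + (ennreal (1/\<beta>) * (ennreal (w x) * indicator J x) + indicator J x)) \<partial>lborel)"
    proof (rule nn_integral_mono)
      fix x
      have "\<Psi> (w x / \<beta> * s) \<le> ennreal N * (\<Phi> (w x / \<beta>) + ennreal (w x / \<beta>) + 1)"
        using s \<beta> w0 by (intro scale) auto
      moreover have "w x / \<beta> * s = w x / \<alpha>" using \<beta> by (simp add: s_def)
      moreover have "ennreal (w x / \<beta>) = ennreal (1/\<beta>) * ennreal (w x)"
        using \<beta> w0[of x] by (simp add: ennreal_mult[symmetric])
      ultimately show "\<Psi> (w x / \<alpha>) * indicator J x \<le> ennreal N * (\<Phi> (w x / \<beta>) * indicator J x + (ennreal (1/\<beta>) * (ennreal (w x) * indicator J x) + indicator J x))"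
        by (auto split: split_indicator simp: add.assoc)
    qed
    also have "\<dots> = ennreal N * ((\<integral>\<^sup>+x\<in>J. \<Phi> (w x / \<beta>) \<partial>lborel) + (ennreal (1/\<beta>) * ?m J + ennreal q))"
    proof -
      have [measurable]: "J \<in> sets borel" by (simp add: J_def)
      have "emeasure lborel J = ennreal q" using q by (simp add: J_def algebra_simps)
      then show ?thesis by (simp add: nn_integral_add nn_integral_cmult)
    qed
    \<comment> \<open>\<open>w / \<beta>\<close> has mean 1 over the cell, so the linear term costs
      exactly as much as the constant one.\<close>
    also have "ennreal (1/\<beta>) * ?m J = ennreal q"
      using \<beta> nu q by (simp add: mJn ennreal_mult[symmetric] \<beta>_def)
    also have "ennreal N * ((\<integral>\<^sup>+x\<in>J. \<Phi> (w x / \<beta>) \<partial>lborel) + (ennreal q + ennreal q))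
      \<le> ennreal N * (ennreal M * ennreal q + (ennreal q + ennreal q))"
      by (intro mult_left_mono add_mono PJ) auto
    also have "\<dots> = ennreal (N * (M + 2) * q)"
      using N M q by (simp add: ennreal_mult[symmetric] ennreal_plus[symmetric] algebra_simps del: ennreal_plus)
    finally show ?thesis by (simp add: J_def)
  qed
  have "(\<integral>\<^sup>+x\<in>Q. \<Psi> (w x / \<alpha>) \<partial>lborel) \<le> (\<integral>\<^sup>+x. \<Psi> (w x / \<alpha>) * indicator {m * q..<(m + 1) * q} x
     + \<Psi> (w x / \<alpha>) * indicator {(m+1::int) * q..<((m + 1::int) + 1) * q} x \<partial>lborel)"
    using m1 m2 q by (intro nn_integral_mono) (auto simp: Q_def algebra_simps split: split_indicator)
  also have "\<dots> = (\<integral>\<^sup>+x\<in>{m * q..<(m + 1) * q}. \<Psi> (w x / \<alpha>) \<partial>lborel)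
      + (\<integral>\<^sup>+x\<in>{(m+1::int) * q..<((m + 1::int) + 1) * q}. \<Psi> (w x / \<alpha>) \<partial>lborel)"
    by (rule nn_integral_add) auto
  also have "\<dots> \<le> ennreal (N * (M + 2) * q) + ennreal (N * (M + 2) * q)"
    by (intro add_mono J) auto
  also have "\<dots> = ennreal (2 * (N * (M + 2)) * q)"
    using N M q by (simp add: ennreal_plus[symmetric] del: ennreal_plus)
  also have "\<dots> \<le> ennreal (2 * (N * (M + 2)) * (2 * l))"
    using N M q by (intro ennreal_leI mult_left_mono) auto
  also have "\<dots> = ennreal (4 * N * (M + 2)) * ennreal l"
    using N M l by (simp add: ennreal_mult[symmetric] algebra_simps)
  finally show "avg {a..a+l} (\<lambda>x. \<Psi> (w x / enn2real (?A {a..a+l}))) \<le> ennreal (4 * N * (M + 2))"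
    using avg_le_iff[of Q] measQ l \<alpha> unfolding Q_def by simp
qed

section \<open>Jensen's inequality and translation averages\<close>

text \<open>Convexity of an extended-valued function, expressed through affine minorants. Nothing is required at
  \<open>v = 0\<close>: a zero mean of a nonnegative function makes it vanish almost everywhere.\<close>

definition sup_of_affine :: "(real \<Rightarrow> ennreal) \<Rightarrow> bool" where
  "sup_of_affine \<Psi> \<longleftrightarrow> (\<forall>v>0. \<forall>y<\<Psi> v. \<exists>c d. y \<le> ennreal (c + d * v) \<and>
     (\<forall>u\<ge>0. ennreal (c + d * u) \<le> \<Psi> u))"

text \<open>\<open>ennreal\<close> truncates negative values to 0, so the right-hand side integrates
  the positive part of \<open>f\<close>. This admits the affine minorants, which may change
  sign.\<close>

lemma ennreal_integral_le_nn_integral: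
  fixes f :: "'a \<Rightarrow> real"
  assumes "integrable M f"
  shows "ennreal (integral\<^sup>L M f) \<le> (\<integral>\<^sup>+x. ennreal (f x) \<partial>M)"
proof -
  have "ennreal (integral\<^sup>L M f) \<le> ennreal (\<integral>x. max 0 (f x) \<partial>M)"
    using assms by (intro ennreal_leI integral_mono) auto
  also have "\<dots> = (\<integral>\<^sup>+x. ennreal (max 0 (f x)) \<partial>M)"
    using assms by (intro nn_integral_eq_integral[symmetric]) auto
  also have "\<dots> = (\<integral>\<^sup>+x. ennreal (f x) \<partial>M)"
    by (intro nn_integral_cong) (simp add: max_def ennreal_neg)
  finally show ?thesis .
qed

text \<open>An affine minorant \<open>c + d * u\<close>, taken at \<open>u = y t / a t\<close> and
  multiplied by \<open>a t\<close>, becomes \<open>c * a t + d * y t\<close>, whose integral is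
  \<open>A\<close> times the minorant at \<open>v\<close>. The bound follows by taking the supremum
  over minorants; \<open>null\<close> keeps the pointwise inequality valid where
  \<open>a t = 0\<close>.\<close>

lemma weighted_jensen_ennreal:
  fixes a y :: "'a \<Rightarrow> real"
  assumes [measurable]: "\<Psi> \<in> borel_measurable borel" and conv: "sup_of_affine \<Psi>"
    and a: "integrable M a" "\<And>t. 0 \<le> a t" and y: "integrable M y" "\<And>t. 0 \<le> y t"
    and null: "AE t in M. a t = 0 \<longrightarrow> y t = 0"
    and A: "A = integral\<^sup>L M a" "0 < A"
  shows "ennreal A * \<Psi> (integral\<^sup>L M y / A) \<le> (\<integral>\<^sup>+t. ennreal (a t) * \<Psi> (y t / a t) \<partial>M)"
proof -
  define v where "v = integral\<^sup>L M y / A"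
  define R where "R = (\<integral>\<^sup>+t. ennreal (a t) * \<Psi> (y t / a t) \<partial>M)"
  have [measurable]: "a \<in> borel_measurable M" "y \<in> borel_measurable M" using a y by auto
  have v0: "0 \<le> v" using y A by (simp add: v_def)
  have "ennreal A * \<Psi> v \<le> R"
  proof (cases "v = 0")
    \<comment> \<open>\<open>sup_of_affine\<close> provides no minorants at 0, but here
      \<open>y\<close> vanishes almost everywhere and both sides equal
      \<open>A * \<Psi> 0\<close>.\<close>
    case True
    then have "integral\<^sup>L M y = 0" using A by (simp add: v_def)
    then have "AE t in M. y t = 0" using y by (simp add: integral_nonneg_eq_0_iff_AE)
    then have "R = (\<integral>\<^sup>+t. ennreal (a t) * \<Psi> 0 \<partial>M)"
      unfolding R_def by (intro nn_integral_cong_AE) auto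
    also have "\<dots> = ennreal A * \<Psi> 0"
      using a A by (simp add: nn_integral_multc nn_integral_eq_integral)
    finally show ?thesis using True by simp
  next
    case False
    then have v: "0 < v" using v0 by simp
    have "\<Psi> v \<le> R / ennreal A"
    \<comment> \<open>\<open>\<Psi> v\<close> may be infinite, so it is approached through values
      strictly below it.\<close>
    proof (rule dense_le)
      fix z assume "z < \<Psi> v"
      then obtain c d where cd: "z \<le> ennreal (c + d * v)" "\<And>u. 0 \<le> u \<Longrightarrow> ennreal (c + d * u) \<le> \<Psi> u"
        using conv v unfolding sup_of_affine_def by blast
      have "z * ennreal A \<le> ennreal (c + d * v) * ennreal A" using cd(1) by (rule mult_right_mono) simp
      also have "\<dots> = ennreal ((c + d * v) * A)" using A by (simp add: ennreal_mult'')
      also have "(c + d * v) * A = (\<integral>t. c * a t + d * y t \<partial>M)"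
        using a y A by (simp add: v_def field_simps)
      also have "ennreal \<dots> \<le> (\<integral>\<^sup>+t. ennreal (c * a t + d * y t) \<partial>M)"
        using a y by (intro ennreal_integral_le_nn_integral) auto
      also have "\<dots> \<le> R" unfolding R_def
      proof (rule nn_integral_mono_AE)
        show "AE t in M. ennreal (c * a t + d * y t) \<le> ennreal (a t) * \<Psi> (y t / a t)"
          using null
        proof eventually_elim
          case (elim t)
          show ?case
          proof (cases "a t = 0")
            case False
            then have at: "0 < a t" using a(2)[of t] by simp
            have "ennreal (c * a t + d * y t) = ennreal (a t * (c + d * (y t / a t)))"
              using at by (simp add: distrib_left mult.commute)
            also have "\<dots> = ennreal (a t) * ennreal (c + d * (y t / a t))"
              using at by (simp add: ennreal_mult')
            also have "\<dots> \<le> ennreal (a t) * \<Psi> (y t / a t)"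
              using at y(2) by (intro mult_left_mono cd(2)) auto
            finally show ?thesis .
          qed (use elim in simp)
        qed
      qed
      finally have "z * ennreal A / ennreal A \<le> R / ennreal A" by (rule divide_right_mono_ennreal)
      then show "z \<le> R / ennreal A" using A by (simp add: ennreal_mult_divide_eq)
    qed
    then have "ennreal A * \<Psi> v \<le> ennreal A * (R / ennreal A)" by (rule mult_left_mono) simp
    also have "\<dots> = R"
      using A by (simp add: ennreal_times_divide mult.commute[of _ R] ennreal_mult_divide_eq)
    finally show ?thesis .
  qed
  then show ?thesis by (simp add: v_def R_def)
qed

section \<open>Averages of translates\<close>

text \<open>Where the integral in \<open>t\<close> diverges, the Bochner integral and
  \<open>enn2real \<infinity>\<close> are both 0, so the identity holds at every
  \<open>x\<close>.\<close>

lemma trans_avg_eq_enn2real: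
  assumes om [measurable]: "(\<lambda>(t, x). om t x) \<in> borel_measurable borel"
    and w: "\<And>t. t \<in> {0..1} \<Longrightarrow> weight (om t)"
  shows "trans_avg om x = enn2real (\<integral>\<^sup>+t\<in>{0..1}. ennreal (om t (x + t)) \<partial>lborel)"
proof -
  have [measurable]: "case_prod om \<in> borel_measurable (borel \<Otimes>\<^sub>M borel)"
    using om by (simp add: borel_prod)
  have "trans_avg om x = enn2real (\<integral>\<^sup>+t. ennreal (indicator {0..1} t * om t (x + t)) \<partial>lborel)"
    unfolding trans_avg_def set_lebesgue_integral_def real_scaleR_def
  proof (rule integral_eq_nn_integral)
    have "(\<lambda>t. case_prod om (t, x + t)) \<in> borel_measurable borel" by measurable
    then show "(\<lambda>t. indicator {0..1} t * om t (x + t)) \<in> borel_measurable lborel" by simp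
  qed (use w in \<open>auto simp: weight_def split: split_indicator\<close>)
  also have "(\<integral>\<^sup>+t. ennreal (indicator {0..1} t * om t (x + t)) \<partial>lborel) = (\<integral>\<^sup>+t\<in>{0..1}. ennreal (om t (x + t)) \<partial>lborel)"
    by (intro nn_integral_cong) (auto split: split_indicator)
  finally show ?thesis .
qed

lemma trans_avg_borel_measurable:
  assumes om: "(\<lambda>(t, x). om t x) \<in> borel_measurable borel"
    and w: "\<And>t. t \<in> {0..1} \<Longrightarrow> weight (om t)"
  shows "trans_avg om \<in> borel_measurable borel"
proof -
  have [measurable]: "case_prod om \<in> borel_measurable (borel \<Otimes>\<^sub>M borel)"
    using om by (simp add: borel_prod)
  have "(\<lambda>z. case_prod om (snd z, fst z + snd z)) \<in> borel_measurable (borel \<Otimes>\<^sub>M lborel)"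
    by measurable
  then have [measurable]: "(\<lambda>(x, t). om t (x + t)) \<in> borel_measurable (borel \<Otimes>\<^sub>M lborel)"
    by (simp add: case_prod_beta')
  have "trans_avg om = (\<lambda>x. enn2real (\<integral>\<^sup>+t\<in>{0..1}. ennreal (om t (x + t)) \<partial>lborel))"
    using trans_avg_eq_enn2real[OF assms] by blast
  then show ?thesis by simp
qed

text \<open>The translate of \<open>om t\<close> over an arc is \<open>om t\<close> over the shifted
  arc, which is why \<open>bound\<close> is required on all arcs. Jensen is applied for fixed
  \<open>x\<close>, with the means of the translates as weights in \<open>t\<close>.\<close>

lemma normalized_mean_le_trans_avg:
  fixes om :: "real \<Rightarrow> real \<Rightarrow> real"
  assumes om: "(\<lambda>(t, x). om t x) \<in> borel_measurable borel"
    and w: "\<And>t. t \<in> {0..1} \<Longrightarrow> weight (om t)"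
    and fin: "(\<integral>\<^sup>+x\<in>{0..1}. (\<integral>\<^sup>+t\<in>{0..1}. ennreal (om t (x + t)) \<partial>lborel) \<partial>lborel) < \<infinity>"
    and [measurable]: "\<Psi> \<in> borel_measurable borel" and conv: "sup_of_affine \<Psi>"
    and bound: "\<And>t a l. t \<in> {0..1} \<Longrightarrow> 0 < l \<Longrightarrow> l \<le> 1 \<Longrightarrow> normalized_mean_le \<Psi> M (om t) {a..a+l}"
    and l: "0 < l" "l \<le> 1"
  shows "avg {a..a+l} (\<lambda>x. ennreal (trans_avg om x)) < \<infinity>"
    and "normalized_mean_le \<Psi> M (trans_avg om) {a..a+l}"
proof -
  have [measurable]: "case_prod om \<in> borel_measurable (borel \<Otimes>\<^sub>M borel)"
    using om by (simp add: borel_prod)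
  \<comment> \<open>Extending by 0 outside the unit interval turns all integrals in \<open>t\<close>
    into integrals over \<open>lborel\<close> and makes \<open>f t\<close> nonnegative and periodic
    for every \<open>t\<close>.\<close>
  define f where "f t x = indicator {0..1} t * om t (x + t)" for t x :: real
  define Q where "Q = {a..a+l}"
  have [measurable]: "Q \<in> sets borel" by (simp add: Q_def)
  have "(\<lambda>z. indicator {0..1} (fst z) * case_prod om (fst z, snd z + fst z)) \<in> borel_measurable (borel \<Otimes>\<^sub>M borel)"
    by measurable
  then have fm [measurable]: "case_prod f \<in> borel_measurable (borel \<Otimes>\<^sub>M borel)"
    by (simp add: f_def case_prod_beta')
  have fm1 [measurable]: "(\<lambda>x. f t x) \<in> borel_measurable borel" for t by measurable
  have fm2 [measurable]: "(\<lambda>t. f t x) \<in> borel_measurable borel" for x by measurable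
  have f0: "0 \<le> f t x" and fper: "f t (x + 1) = f t x" for t x
    using w[of t] unfolding weight_def f_def
    by (auto split: split_indicator) (metis add.commute add.left_commute)
  have omm [measurable]: "om t \<in> borel_measurable borel" for t by measurable
  \<comment> \<open>\<open>g\<close> is the average before \<open>enn2real\<close> is applied; the
    two agree almost everywhere on \<open>Q\<close> because \<open>g\<close> has finite integral
    there.\<close>
  define g where "g x = (\<integral>\<^sup>+t. ennreal (f t x) \<partial>lborel)" for x
  have gm [measurable]: "g \<in> borel_measurable borel" unfolding g_def by measurable
  have g_eq: "g x = (\<integral>\<^sup>+t\<in>{0..1}. ennreal (om t (x + t)) \<partial>lborel)" for x
    unfolding g_def f_def by (intro nn_integral_cong) (auto split: split_indicator)
  have gper: "g (x + 1) = g x" for x by (simp add: g_def fper)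
  have ta: "trans_avg om x = enn2real (g x)" for x
    unfolding g_eq by (rule trans_avg_eq_enn2real[OF om w])
  define G where "G = (\<integral>\<^sup>+x\<in>Q. g x \<partial>lborel)"
  have Gfin: "G < \<infinity>"
  proof -
    have "G \<le> (\<integral>\<^sup>+x\<in>{0..1}. g x \<partial>lborel)"
      unfolding G_def Q_def using l gper by (intro set_nn_integral_periodic_le_full) auto
    then show ?thesis using fin by (simp add: g_eq)
  qed
  define A where "A = enn2real G / l"
  have GA: "G = ennreal A * ennreal l" and A0: "0 \<le> A"
    using Gfin l by (auto simp: A_def ennreal_mult[symmetric] less_top)
  have measQ: "measure lborel Q = l" using l by (simp add: Q_def)
  have gfin: "AE x in lborel. x \<in> Q \<longrightarrow> g x < \<infinity>"
  proof -
    have "AE x in lborel. g x * indicator Q x \<noteq> \<infinity>"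
      using Gfin by (intro nn_integral_PInf_AE) (auto simp: G_def)
    then show ?thesis by eventually_elim (auto simp: less_top)
  qed
  have "(\<integral>\<^sup>+x\<in>Q. ennreal (trans_avg om x) \<partial>lborel) = G"
    unfolding G_def ta
    by (intro nn_integral_cong_AE) (use gfin in eventually_elim, auto split: split_indicator)
  then have avgQ: "avg Q (\<lambda>x. ennreal (trans_avg om x)) = ennreal A"
    using l by (simp add: avg_def measQ GA ennreal_mult_divide_eq)
  then show "avg {a..a+l} (\<lambda>x. ennreal (trans_avg om x)) < \<infinity>" by (simp add: Q_def)
  define m where "m t = (\<integral>\<^sup>+x\<in>Q. ennreal (f t x) \<partial>lborel)" for t
  have mm [measurable]: "m \<in> borel_measurable borel" unfolding m_def by measurable
  have m_out: "m t = 0" if "t \<notin> {0..1}" for t using that by (simp add: m_def f_def)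
  have shift: "(\<integral>\<^sup>+x\<in>{a+t..a+t+l}. F (om t x) \<partial>lborel) = (\<integral>\<^sup>+x\<in>Q. F (f t x) \<partial>lborel)"
    if t: "t \<in> {0..1}" and [measurable]: "F \<in> borel_measurable borel" for t and F :: "real \<Rightarrow> ennreal"
  proof -
    have "(\<integral>\<^sup>+x\<in>{a+t..a+t+l}. F (om t x) \<partial>lborel)
        = (\<integral>\<^sup>+x. F (om t (x + t)) * indicator {a+t..a+t+l} (x + t) \<partial>lborel)"
      by (rule set_nn_integral_shift) auto
    also have "\<dots> = (\<integral>\<^sup>+x\<in>Q. F (f t x) \<partial>lborel)"
      using t by (intro nn_integral_cong) (auto simp: f_def Q_def split: split_indicator)
    finally show ?thesis .
  qed
  have mfin: "m t < \<infinity>" for t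
  proof (cases "t \<in> {0..1}")
    case True
    have "(\<integral>\<^sup>+x\<in>{a+t..a+t+l}. ennreal (om t x) \<partial>lborel) < \<infinity>"
      using l w[OF True] by (intro weight_set_nn_integral_finite) auto
    then show ?thesis using shift[OF True, of ennreal] by (simp add: m_def)
  qed (simp add: m_out)
  define \<alpha> where "\<alpha> t = enn2real (m t) / l" for t
  have \<alpha>m [measurable]: "\<alpha> \<in> borel_measurable borel" unfolding \<alpha>_def by measurable
  have \<alpha>0: "0 \<le> \<alpha> t" for t using l by (simp add: \<alpha>_def)
  have m\<alpha>: "m t = ennreal (\<alpha> t) * ennreal l" for t
    using mfin[of t] l by (simp add: \<alpha>_def ennreal_mult[symmetric] less_top)
  have \<alpha>_eq: "ennreal (\<alpha> t) = m t / ennreal l" for t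
    using l by (simp add: m\<alpha> ennreal_mult_divide_eq)
  \<comment> \<open>By Tonelli the masses of the translates integrate to the mass of the average, so
    the weights \<open>\<alpha>\<close> integrate to \<open>A\<close>.\<close>
  have Gm: "(\<integral>\<^sup>+t. m t \<partial>lborel) = G"
  proof -
    have "(\<integral>\<^sup>+t. m t \<partial>lborel) = (\<integral>\<^sup>+x. (\<integral>\<^sup>+t. ennreal (f t x) * indicator Q x \<partial>lborel) \<partial>lborel)"
      unfolding m_def by (rule lborel_pair.Fubini') measurable
    also have "\<dots> = G" unfolding G_def g_def by (simp add: nn_integral_multc)
    finally show ?thesis .
  qed
  have n\<alpha>: "(\<integral>\<^sup>+t. ennreal (\<alpha> t) \<partial>lborel) = ennreal A"
    using l by (simp add: \<alpha>_eq nn_integral_divide Gm GA ennreal_mult_divide_eq)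
  have i\<alpha>: "integrable lborel \<alpha>"
    using \<alpha>0 n\<alpha> by (intro integrableI_nn_integral_finite[of _ _ A]) (auto simp: A0)
  have A_eq: "A = integral\<^sup>L lborel \<alpha>"
    using \<alpha>0 n\<alpha> A0 by (subst integral_eq_nn_integral) auto
  show "normalized_mean_le \<Psi> M (trans_avg om) {a..a+l}"
    unfolding normalized_mean_le_def Q_def[symmetric] avgQ
  proof
    assume "ennreal A \<noteq> 0"
    then have Apos: "0 < A" using A0 by (cases "A = 0") auto
    \<comment> \<open>If \<open>\<alpha> t = 0\<close>, the translate vanishes for almost every
      \<open>x\<close> in \<open>Q\<close>. Jensen needs the quantifiers in the other order, almost
      every \<open>x\<close> first, and swapping the integrals provides it.\<close>
    have null: "AE x in lborel. x \<in> Q \<longrightarrow> (AE t in lborel. \<alpha> t = 0 \<longrightarrow> f t x = 0)"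
    proof -
      let ?Z = "{t. \<alpha> t = 0}"
      have "(\<integral>\<^sup>+x. (\<integral>\<^sup>+t. ennreal (f t x) * indicator ?Z t * indicator Q x \<partial>lborel) \<partial>lborel)
        = (\<integral>\<^sup>+t. (\<integral>\<^sup>+x. ennreal (f t x) * indicator ?Z t * indicator Q x \<partial>lborel) \<partial>lborel)"
        by (rule lborel_pair.Fubini'[symmetric]) measurable
      also have "\<dots> = (\<integral>\<^sup>+t. m t * indicator ?Z t \<partial>lborel)"
      proof (rule nn_integral_cong)
        fix t
        show "(\<integral>\<^sup>+x. ennreal (f t x) * indicator ?Z t * indicator Q x \<partial>lborel) = m t * indicator ?Z t"
          by (cases "\<alpha> t = 0") (simp_all add: m_def)
      qed
      also have "\<dots> = (\<integral>\<^sup>+t. 0 \<partial>(lborel :: real measure))"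
        by (intro nn_integral_cong) (auto simp: m\<alpha> split: split_indicator)
      finally have "AE x in lborel. (\<integral>\<^sup>+t. ennreal (f t x) * indicator ?Z t * indicator Q x \<partial>lborel) = 0"
        by (subst nn_integral_0_iff_AE[symmetric]) auto
      then show ?thesis
      proof eventually_elim
        case (elim x)
        show ?case
        proof
          assume "x \<in> Q"
          then have "AE t in lborel. ennreal (f t x) * indicator ?Z t = 0"
            using elim by (simp add: nn_integral_0_iff_AE)
          then show "AE t in lborel. \<alpha> t = 0 \<longrightarrow> f t x = 0"
            by eventually_elim (use f0 in \<open>auto simp: ennreal_eq_0_iff intro: antisym\<close>)
        qed
      qed
    qed
    have "ennreal A * (\<integral>\<^sup>+x\<in>Q. \<Psi> (trans_avg om x / A) \<partial>lborel)
      = (\<integral>\<^sup>+x. ennreal A * \<Psi> (trans_avg om x / A) * indicator Q x \<partial>lborel)"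
      unfolding ta by (simp add: nn_integral_cmult[symmetric] mult.assoc)
    also have "\<dots> \<le> (\<integral>\<^sup>+x. (\<integral>\<^sup>+t. ennreal (\<alpha> t) * \<Psi> (f t x / \<alpha> t) * indicator Q x \<partial>lborel) \<partial>lborel)"
    proof (rule nn_integral_mono_AE)
      show "AE x in lborel. ennreal A * \<Psi> (trans_avg om x / A) * indicator Q x
         \<le> (\<integral>\<^sup>+t. ennreal (\<alpha> t) * \<Psi> (f t x / \<alpha> t) * indicator Q x \<partial>lborel)"
        using null gfin
      proof eventually_elim
        case (elim x)
        show ?case
        proof (cases "x \<in> Q")
          case True
          have gx: "g x < \<infinity>" and nx: "AE t in lborel. \<alpha> t = 0 \<longrightarrow> f t x = 0" using elim True by auto
          have ify: "integrable lborel (\<lambda>t. f t x)"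
            using f0 gx by (intro integrableI_nonneg) (auto simp: g_def)
          have "integral\<^sup>L lborel (\<lambda>t. f t x) = trans_avg om x"
            unfolding ta g_def using f0 by (intro integral_eq_nn_integral) auto
          then show ?thesis
            using weighted_jensen_ennreal[OF _ conv i\<alpha> \<alpha>0 ify f0 nx A_eq Apos] True by simp
        qed simp
      qed
    qed
    \<comment> \<open>After the swap the inner integral is, up to the factor
      \<open>\<alpha> t\<close>, a normalized integral of a single translate, controlled by
      \<open>bound\<close> on the arc shifted by \<open>t\<close>.\<close>
    also have "\<dots> = (\<integral>\<^sup>+t. (\<integral>\<^sup>+x. ennreal (\<alpha> t) * \<Psi> (f t x / \<alpha> t) * indicator Q x \<partial>lborel) \<partial>lborel)"
      by (rule lborel_pair.Fubini'[symmetric]) measurable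
    also have "\<dots> \<le> (\<integral>\<^sup>+t. ennreal (\<alpha> t) * (ennreal M * ennreal l) \<partial>lborel)"
    proof (rule nn_integral_mono)
      fix t :: real
      have eq: "(\<integral>\<^sup>+x. ennreal (\<alpha> t) * \<Psi> (f t x / \<alpha> t) * indicator Q x \<partial>lborel)
          = ennreal (\<alpha> t) * (\<integral>\<^sup>+x\<in>Q. \<Psi> (f t x / \<alpha> t) \<partial>lborel)"
        by (simp add: nn_integral_cmult[symmetric] mult.assoc)
      show "(\<integral>\<^sup>+x. ennreal (\<alpha> t) * \<Psi> (f t x / \<alpha> t) * indicator Q x \<partial>lborel)
         \<le> ennreal (\<alpha> t) * (ennreal M * ennreal l)"
      proof (cases "\<alpha> t = 0")
        case False
        then have t: "t \<in> {0..1}" using m_out[of t] by (force simp: \<alpha>_def)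
        have meas': "measure lborel {a+t..a+t+l} = l" using l by simp
        have av: "avg {a+t..a+t+l} (\<lambda>x. ennreal (om t x)) = ennreal (\<alpha> t)"
          unfolding avg_def meas' \<alpha>_eq m_def using shift[OF t, of ennreal] by simp
        have "avg {a+t..a+t+l} (\<lambda>x. \<Psi> (om t x / \<alpha> t)) \<le> ennreal M"
          using bound[OF t l, of "a+t"] False \<alpha>0[of t]
          unfolding normalized_mean_le_def av by (simp add: ennreal_eq_0_iff)
        then have "(\<integral>\<^sup>+x\<in>{a+t..a+t+l}. \<Psi> (om t x / \<alpha> t) \<partial>lborel) \<le> ennreal M * ennreal l"
          using avg_le_iff[of "{a+t..a+t+l}"] l meas' by simp
        then have "(\<integral>\<^sup>+x\<in>Q. \<Psi> (f t x / \<alpha> t) \<partial>lborel) \<le> ennreal M * ennreal l"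
          using shift[OF t, of "\<lambda>u. \<Psi> (u / \<alpha> t)"] by simp
        then show ?thesis unfolding eq by (rule mult_left_mono) simp
      qed simp
    qed
    also have "\<dots> = ennreal A * (ennreal M * ennreal l)"
      by (simp add: nn_integral_multc n\<alpha>)
    finally have "(\<integral>\<^sup>+x\<in>Q. \<Psi> (trans_avg om x / A) \<partial>lborel) \<le> ennreal M * ennreal l"
      using Apos by (subst (asm) ennreal_mult_le_mult_iff) auto
    then show "avg Q (\<lambda>x. \<Psi> (trans_avg om x / enn2real (ennreal A))) \<le> ennreal M"
      using avg_le_iff[of Q] measQ l A0 by simp
  qed
qed

section \<open>The power-type conditions\<close>

text \<open>These side conditions hold alike for the weights on dyadic intervals and for their
  average on arcs, so one description of each functional serves both hypothesis and
  conclusion.\<close>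

definition averageable :: "(real \<Rightarrow> real) \<Rightarrow> real set \<Rightarrow> bool" where
  "averageable w Q \<longleftrightarrow> w \<in> borel_measurable borel \<and> (\<forall>x. 0 \<le> w x) \<and> Q \<in> sets borel \<and>
     emeasure lborel Q < \<infinity> \<and> 0 < measure lborel Q \<and> avg Q (\<lambda>x. ennreal (w x)) < \<infinity>"

text \<open>Reduces every case to facts about one functional \<open>F\<close>: a bound on
  \<open>F\<close> controls a \<open>\<Phi>\<close>-mean, a \<open>\<Psi>\<close>-mean controls
  \<open>F\<close>, and rescaling leads from \<open>\<Phi>\<close> to \<open>\<Psi>\<close>. Two
  gauges are allowed because the thresholds of the limiting cases move under rescaling.\<close>

lemma trans_avg_functional_bound:
  assumes meas: "\<Phi> \<in> borel_measurable borel" "\<Psi> \<in> borel_measurable borel"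
    and conv: "sup_of_affine \<Psi>" and M: "0 \<le> M" and N: "0 \<le> N" and C: "1 \<le> C" "Cdbl \<le> C"
    and scale: "\<And>u s. 0 \<le> u \<Longrightarrow> 1 / (2 * C^3) \<le> s \<Longrightarrow> s \<le> 2 * C^3 \<Longrightarrow>
      \<Psi> (u * s) \<le> ennreal N * (\<Phi> u + ennreal u + 1)"
    and dyadic: "\<And>w Q. averageable w Q \<Longrightarrow> F w Q \<le> ennreal V \<Longrightarrow> normalized_mean_le \<Phi> M w Q"
    and arc: "\<And>w Q. averageable w Q \<Longrightarrow> normalized_mean_le \<Psi> (4 * N * (M + 2)) w Q \<Longrightarrow> F w Q \<le> ennreal K"
  shows "\<exists>K::real. \<forall>om :: real \<Rightarrow> real \<Rightarrow> real.
        (\<lambda>(t, x). om t x) \<in> borel_measurable borel \<and>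
        (\<forall>t\<in>{0..1}. weight (om t) \<and> doubling Cdbl (om t) \<and> (SUP I\<in>dyadics. F (om t) I) \<le> ennreal V) \<and>
        (\<integral>\<^sup>+x\<in>{0..1}. (\<integral>\<^sup>+t\<in>{0..1}. ennreal (om t (x + t)) \<partial>lborel) \<partial>lborel) < \<infinity>
        \<longrightarrow> (SUP Q\<in>arcs. F (trans_avg om) Q) \<le> ennreal K"
proof (intro exI[of _ K] allI impI SUP_least)
  fix om :: "real \<Rightarrow> real \<Rightarrow> real" and Q :: "real set"
  assume H: "(\<lambda>(t, x). om t x) \<in> borel_measurable borel \<and>
        (\<forall>t\<in>{0..1}. weight (om t) \<and> doubling Cdbl (om t) \<and> (SUP I\<in>dyadics. F (om t) I) \<le> ennreal V) \<and>
        (\<integral>\<^sup>+x\<in>{0..1}. (\<integral>\<^sup>+t\<in>{0..1}. ennreal (om t (x + t)) \<partial>lborel) \<partial>lborel) < \<infinity>"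
    and Q: "Q \<in> arcs"
  then have om: "(\<lambda>(t, x). om t x) \<in> borel_measurable borel"
    and w: "\<And>t. t \<in> {0..1} \<Longrightarrow> weight (om t)"
    and fin: "(\<integral>\<^sup>+x\<in>{0..1}. (\<integral>\<^sup>+t\<in>{0..1}. ennreal (om t (x + t)) \<partial>lborel) \<partial>lborel) < \<infinity>"
    by auto
  obtain a l where l: "0 < l" "l \<le> 1" and Q: "Q = {a..a+l}" using Q by (auto simp: arcs_def)
  have [measurable]: "case_prod om \<in> borel_measurable (borel \<Otimes>\<^sub>M borel)"
    using om by (simp add: borel_prod)
  have bound: "normalized_mean_le \<Psi> (4 * N * (M + 2)) (om t) {a..a+l}"
    if t: "t \<in> {0..1}" and l: "0 < l" "l \<le> 1" for t a l
  proof -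
    have omt [measurable]: "om t \<in> borel_measurable borel" by measurable
    have dbl: "doubling C (om t)" using H t C(2) doubling_mono by blast
    have dy: "normalized_mean_le \<Phi> M (om t) (dyadic_ivl k j)" if j: "j < 2^k" for k j :: nat
    proof -
      have j1: "real j + 1 \<le> 2^k"
      proof -
        have "real (Suc j) \<le> real (2^k)" using j by (intro of_nat_mono) simp
        then show ?thesis by simp
      qed
      then have j2: "(real j + 1) / 2^k \<le> 1" "real j / 2^k < (real j + 1) / 2^k"
        by (simp_all add: divide_strict_right_mono)
      have meas1: "measure lborel (dyadic_ivl k j) = (real j + 1) / 2^k - real j / 2^k"
        "emeasure lborel (dyadic_ivl k j) < \<infinity>"
        using j2 by (auto simp: dyadic_ivl_def)
      have "(\<integral>\<^sup>+x\<in>{real j / 2^k..(real j + 1) / 2^k}. ennreal (om t x) \<partial>lborel) < \<infinity>"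
        using w[OF t] j2 by (intro weight_set_nn_integral_finite) (auto intro: add_increasing)
      then have mass: "(\<integral>\<^sup>+x\<in>dyadic_ivl k j. ennreal (om t x) \<partial>lborel) < \<infinity>"
        unfolding set_nn_integral_closed_eq_halfopen dyadic_ivl_def .
      have "averageable (om t) (dyadic_ivl k j)"
        unfolding averageable_def
        using w[OF t] mass meas1 j2
        by (auto simp: weight_def dyadic_ivl_def avg_def ennreal_divide_eq_top_iff less_top[symmetric])
      moreover have "F (om t) (dyadic_ivl k j) \<le> ennreal V"
      proof -
        have "dyadic_ivl k j \<in> dyadics" using j by (auto simp: dyadics_def)
        moreover have "(SUP I\<in>dyadics. F (om t) I) \<le> ennreal V" using H t by blast
        ultimately show ?thesis unfolding SUP_le_iff by blast
      qed
      ultimately show ?thesis by (rule dyadic)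
    qed
    show ?thesis
      by (rule normalized_mean_le_arc_of_dyadic[OF omt meas w[OF t] dbl C(1) dy M N scale l])
  qed
  have fin_avg: "avg Q (\<lambda>x. ennreal (trans_avg om x)) < \<infinity>"
    unfolding Q by (rule normalized_mean_le_trans_avg(1)[OF om w fin meas(2) conv bound l])
  have mean: "normalized_mean_le \<Psi> (4 * N * (M + 2)) (trans_avg om) Q"
    unfolding Q by (rule normalized_mean_le_trans_avg(2)[OF om w fin meas(2) conv bound l])
  have "trans_avg om \<in> borel_measurable borel"
    by (rule trans_avg_borel_measurable[OF om w])
  moreover have "0 \<le> trans_avg om x" for x
    by (subst trans_avg_eq_enn2real[OF om w]) auto
  ultimately have "averageable (trans_avg om) Q"
    unfolding averageable_def using fin_avg l by (simp add: Q)
  then show "F (trans_avg om) Q \<le> ennreal K" using mean by (rule arc)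
qed

lemma avg_cmult:
  assumes [measurable]: "f \<in> borel_measurable borel" "Q \<in> sets borel"
  shows "avg Q (\<lambda>x. c * f x) = c * avg Q f"
  unfolding avg_def by (simp add: mult.assoc nn_integral_cmult ennreal_times_divide)

lemma epowr_le: "epowr X s \<le> ennreal (M powr s)" if "0 < s" "0 \<le> M" "X \<le> ennreal M"
proof -
  have X: "X \<noteq> \<infinity>" using that by (auto simp: top_unique)
  have "enn2real X \<le> M" using that by (simp add: enn2real_leI)
  then show ?thesis using X that by (auto simp: epowr_def intro!: ennreal_leI powr_mono2)
qed

lemma le_of_epowr_le: "X \<le> ennreal (V powr (1 / s))" if "0 < s" "0 \<le> V" "epowr X s \<le> ennreal V"
proof -
  have X: "X \<noteq> \<infinity>" using that by (auto simp: epowr_def top_unique)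
  have "enn2real X powr s \<le> V" using that X by (simp add: epowr_def)
  then have "(enn2real X powr s) powr (1 / s) \<le> V powr (1 / s)" using that by (intro powr_mono2) auto
  then have "enn2real X \<le> V powr (1 / s)" using that by (simp add: powr_powr)
  then show ?thesis using X by (metis ennreal_enn2real ennreal_leI infinity_ennreal_def less_top)
qed

lemma epowr_cmult: "epowr (ennreal c * X) s = ennreal (c powr s) * epowr X s" if "0 < c"
proof (cases "X = \<infinity>")
  case True
  then show ?thesis using that by (simp add: epowr_def ennreal_mult_top)
next
  case False
  then have "ennreal c * X \<noteq> \<infinity>" by (simp add: ennreal_mult_eq_top_iff)
  then show ?thesis using False that
    by (simp add: epowr_def enn2real_mult powr_mult ennreal_mult)
qed

lemma averageable_avg_cases:
  assumes "averageable w Q"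
  obtains "avg Q (\<lambda>x. ennreal (w x)) = 0"
  | a where "0 < a" "avg Q (\<lambda>x. ennreal (w x)) = ennreal a"
proof (cases "avg Q (\<lambda>x. ennreal (w x)) = 0")
  case False
  moreover have "avg Q (\<lambda>x. ennreal (w x)) = ennreal (enn2real (avg Q (\<lambda>x. ennreal (w x))))"
    using assms by (simp add: averageable_def)
  ultimately show thesis using that(2) by (metis enn2real_nonneg ennreal_0 order_less_le)
qed (rule that(1))

lemma AE_zero_of_avg_eq_0:
  assumes "averageable w Q" "avg Q (\<lambda>x. ennreal (w x)) = 0"
  shows "AE x in lborel. x \<in> Q \<longrightarrow> w x = 0"
proof -
  have [measurable]: "w \<in> borel_measurable borel" "Q \<in> sets borel" and w0: "\<And>x. 0 \<le> w x"
    using assms by (auto simp: averageable_def)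
  have "(\<integral>\<^sup>+x\<in>Q. ennreal (w x) \<partial>lborel) = 0"
    using assms(2) by (simp add: avg_def ennreal_divide_eq_0_iff)
  then have "AE x in lborel. ennreal (w x) * indicator Q x = 0"
    by (subst (asm) nn_integral_0_iff_AE) auto
  then show ?thesis
    by eventually_elim (use w0 in \<open>auto simp: ennreal_eq_0_iff intro: antisym\<close>)
qed

lemma dual_pow_measurable [measurable]: "dual_pow p (\<lambda>u. u) \<in> borel_measurable borel"
  unfolding dual_pow_def by measurable

text \<open>By homogeneity, dividing by \<open>a\<close> pulls out
  \<open>a powr (1 / (p - 1))\<close>, which the outer power turns into \<open>a\<close>, the first
  factor of \<open>Ap_on\<close>. At zeros of \<open>w\<close> both sides of the pointwise identity
  are infinite.\<close>

lemma Ap_on_eq_epowr_normalized: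
  assumes "averageable w Q" and a: "0 < a" "avg Q (\<lambda>x. ennreal (w x)) = ennreal a" and p: "1 < p"
  shows "Ap_on (ereal p) w Q = epowr (avg Q (\<lambda>x. dual_pow p (\<lambda>u. u) (w x / a))) (p - 1)"
proof -
  have [measurable]: "w \<in> borel_measurable borel" "Q \<in> sets borel" and w0: "\<And>x. 0 \<le> w x"
    using assms by (auto simp: averageable_def)
  have [measurable]: "dual_pow p w \<in> borel_measurable borel" unfolding dual_pow_def by measurable
  have "dual_pow p (\<lambda>u. u) (w x / a) = ennreal (a powr (1 / (p - 1))) * dual_pow p w x" for x
  proof (cases "w x = 0")
    case True
    then show ?thesis using a by (simp add: dual_pow_def ennreal_mult_top)
  next
    case False
    then have "0 < w x" using w0[of x] by simp
    then have "(w x / a) powr (- 1 / (p - 1)) = a powr (1 / (p - 1)) * w x powr (- 1 / (p - 1))"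
      using a by (simp add: powr_divide powr_minus_divide field_simps)
    then show ?thesis using False a by (simp add: dual_pow_def ennreal_mult)
  qed
  then have "avg Q (\<lambda>x. dual_pow p (\<lambda>u. u) (w x / a)) = ennreal (a powr (1 / (p - 1))) * avg Q (dual_pow p w)"
    by (simp add: avg_cmult)
  then have "epowr (avg Q (\<lambda>x. dual_pow p (\<lambda>u. u) (w x / a))) (p - 1) = ennreal a * epowr (avg Q (dual_pow p w)) (p - 1)"
    using a p by (simp add: epowr_cmult powr_powr)
  then show ?thesis using p a by (simp add: Ap_on_def one_ereal_def)
qed

text \<open>The factor \<open>a powr (- p)\<close> leaves the outer root as \<open>1 / a\<close>,
  supplying the denominator of \<open>RH_on\<close>.\<close>

lemma RH_on_eq_epowr_normalized:
  assumes "averageable w Q" and a: "0 < a" "avg Q (\<lambda>x. ennreal (w x)) = ennreal a" and p: "1 < p"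
  shows "RH_on (ereal p) w Q = epowr (avg Q (\<lambda>x. ennreal ((w x / a) powr p))) (1 / p)"
proof -
  have [measurable]: "w \<in> borel_measurable borel" "Q \<in> sets borel" and w0: "\<And>x. 0 \<le> w x"
    using assms by (auto simp: averageable_def)
  have "ennreal ((w x / a) powr p) = ennreal (a powr (- p)) * ennreal (w x powr p)" for x
    using a w0[of x] by (simp add: powr_divide powr_minus_divide ennreal_mult[symmetric])
  then have "avg Q (\<lambda>x. ennreal ((w x / a) powr p)) = ennreal (a powr (- p)) * avg Q (\<lambda>x. ennreal (w x powr p))"
    by (simp add: avg_cmult)
  then have "epowr (avg Q (\<lambda>x. ennreal ((w x / a) powr p))) (1 / p)
      = ennreal (1 / a) * epowr (avg Q (\<lambda>x. ennreal (w x powr p))) (1 / p)"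
    using a p by (simp add: epowr_cmult powr_powr powr_minus_divide[of a 1])
  also have "\<dots> = epowr (avg Q (\<lambda>x. ennreal (w x powr p))) (1 / p) / ennreal a"
    using a by (simp add: divide_ennreal_def inverse_ennreal mult.commute inverse_eq_divide)
  finally show ?thesis using a by (simp add: RH_on_def)
qed

section \<open>Affine minorants of the power gauges\<close>

text \<open>Where \<open>\<Psi>\<close> is finite, a single supporting line attains its value and
  serves for every \<open>y\<close> below it; \<open>\<phi>'\<close> only has to be a slope of such
  a line.\<close>

lemma sup_of_affine_tangentI:
  assumes "\<And>v. 0 < v \<Longrightarrow> \<Psi> v = ennreal (\<phi> v)"
    and "\<And>v u. 0 < v \<Longrightarrow> 0 \<le> u \<Longrightarrow> ennreal (\<phi> v + \<phi>' v * (u - v)) \<le> \<Psi> u"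
  shows "sup_of_affine \<Psi>"
  unfolding sup_of_affine_def
proof (intro allI impI)
  fix v y assume v: "0 < (v::real)" and y: "y < \<Psi> v"
  have eq: "\<phi> v - \<phi>' v * v + \<phi>' v * u = \<phi> v + \<phi>' v * (u - v)" for u by (simp add: algebra_simps)
  show "\<exists>c d. y \<le> ennreal (c + d * v) \<and> (\<forall>u\<ge>0. ennreal (c + d * u) \<le> \<Psi> u)"
    using v y assms by (intro exI[of _ "\<phi> v - \<phi>' v * v"] exI[of _ "\<phi>' v"]) (auto simp: eq)
qed

text \<open>With \<open>z = u / v\<close>, tangency reduces to the Bernoulli-type inequality
  \<open>1 - r * (z - 1) \<le> z powr (- r)\<close>, which follows from
  \<open>ln z \<le> z - 1\<close> and \<open>1 + x \<le> exp x\<close>. At 0 the gauge is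
  infinite.\<close>

lemma sup_of_affine_dual_pow:
  assumes p: "1 < p"
  shows "sup_of_affine (dual_pow p (\<lambda>u. u))"
proof (rule sup_of_affine_tangentI)
  define r where "r = 1 / (p - 1)"
  have r: "0 < r" "- 1 / (p - 1) = - r" using p by (auto simp: r_def)
  fix v :: real assume v: "0 < v"
  show "dual_pow p (\<lambda>u. u) v = ennreal (v powr (- 1 / (p - 1)))" using v by (simp add: dual_pow_def)
  fix u :: real assume u: "0 \<le> u"
  let ?d = "\<lambda>v. (- 1 / (p - 1)) * v powr (- 1 / (p - 1)) / v"
  show "ennreal (v powr (- 1 / (p - 1)) + ?d v * (u - v)) \<le> dual_pow p (\<lambda>u. u) u"
  proof (cases "u = 0")
    case False
    then have u: "0 < u" using u by simp
    define z where "z = u / v"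
    have z: "0 < z" using u v by (simp add: z_def)
    have "r * ln z \<le> r * (z - 1)" using r ln_le_minus_one[OF z] by (intro mult_left_mono) auto
    then have "1 - r * (z - 1) \<le> 1 + (- r * ln z)" by simp
    also have "\<dots> \<le> z powr (- r)" using exp_ge_add_one_self[of "- r * ln z"] z by (simp add: powr_def)
    finally have "v powr (- r) * (1 - r * (z - 1)) \<le> v powr (- r) * z powr (- r)"
      by (intro mult_left_mono) auto
    also have "\<dots> = u powr (- r)" using v z by (simp add: powr_mult[symmetric] z_def)
    finally have "v powr (- r) + (- r) * v powr (- r) / v * (u - v) \<le> u powr (- r)"
      using v by (simp add: z_def field_simps)
    then show ?thesis using u unfolding dual_pow_def r(2) by (auto intro: ennreal_leI)
  qed (simp add: dual_pow_def)
qed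

lemma sup_of_affine_powr:
  assumes p: "1 < p"
  shows "sup_of_affine (\<lambda>u. ennreal (u powr p))"
proof (rule sup_of_affine_tangentI[OF refl])
  fix u v :: real assume v: "0 < v" and u: "0 \<le> u"
  show "ennreal (v powr p + p * v powr (p - 1) * (u - v)) \<le> ennreal (u powr p)"
  proof (cases "u = 0")
    \<comment> \<open>Convexity is used on the open half-line, so 0 is treated by hand: there the
      tangent has the value \<open>(1 - p) * v powr p\<close>, which is not positive.\<close>
    case True
    have "v powr (p - 1) * v = v powr p" using v by (simp add: powr_mult_base mult.commute)
    then have "v powr p + p * v powr (p - 1) * (u - v) = (1 - p) * v powr p"
      using True by (simp add: algebra_simps)
    also have "\<dots> \<le> 0" using p by (simp add: mult_nonpos_nonneg)
    finally show ?thesis by (simp add: ennreal_neg)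
  next
    case False
    have "convex_on {0<..} (\<lambda>x. x powr p)"
      using p by (intro convex_on_subset[OF powr_convex]) auto
    moreover have "((\<lambda>x. x powr p) has_real_derivative p * v powr (p - 1)) (at v within {0<..})"
      using v by (auto intro!: derivative_eq_intros)
    ultimately have "p * v powr (p - 1) * (u - v) \<le> u powr p - v powr p"
      using u v False by (intro convex_on_imp_above_tangent[of "{0<..}"]) (auto simp: interior_open)
    then show ?thesis by (intro ennreal_leI) simp
  qed
qed

section \<open>The limiting conditions\<close>

text \<open>Adding \<open>u - 1\<close>, which has mean zero for a normalized weight, makes \<open>- ln u\<close> nonnegative, so no
  positive and negative parts have to be separated.\<close>

definition log_gauge :: "real \<Rightarrow> ennreal" where
  "log_gauge u = (if u = 0 then \<infinity> else ennreal (u - ln u - 1))"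

lemma log_gauge_measurable [measurable]: "log_gauge \<in> borel_measurable borel"
  unfolding log_gauge_def by measurable

text \<open>For positive \<open>u\<close> the gap between the gauge and its tangent at
  \<open>v\<close> is \<open>u / v - 1 - ln (u / v)\<close>, hence nonnegative.\<close>

lemma sup_of_affine_log_gauge: "sup_of_affine log_gauge"
proof (rule sup_of_affine_tangentI)
  fix v :: real assume v: "0 < v"
  show "log_gauge v = ennreal (v - ln v - 1)" using v by (simp add: log_gauge_def)
  fix u :: real assume u: "0 \<le> u"
  show "ennreal (v - ln v - 1 + (1 - 1 / v) * (u - v)) \<le> log_gauge u"
  proof (cases "u = 0")
    case False
    then have u: "0 < u" using u by simp
    have "ln (u / v) \<le> u / v - 1" using u v by (intro ln_le_minus_one) simp
    then have "v - ln v - 1 + (1 - 1 / v) * (u - v) \<le> u - ln u - 1"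
      using u v by (simp add: ln_div field_simps)
    then show ?thesis using u by (simp add: log_gauge_def ennreal_leI)
  qed (simp add: log_gauge_def)
qed

text \<open>For \<open>u = w / a\<close> the mean of \<open>u - 1\<close> is 0 and the mean of
  \<open>- ln u\<close> is that of \<open>- ln w\<close> plus \<open>ln a\<close>; exponentiating
  restores the factor \<open>a\<close>. Most of the work matches the infinite cases of
  \<open>exp_avg_log_inv\<close>.\<close>

lemma Ap_on_infinity_eq_exp_normalized:
  assumes av: "averageable w Q" and a: "0 < a" "avg Q (\<lambda>x. ennreal (w x)) = ennreal a"
  defines "X \<equiv> avg Q (\<lambda>x. log_gauge (w x / a))"
  shows "Ap_on \<infinity> w Q = (if X = \<infinity> then \<infinity> else ennreal (exp (enn2real X)))"
proof -
  have [measurable]: "w \<in> borel_measurable borel" "Q \<in> sets borel" and w0: "\<And>x. 0 \<le> w x"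
    and Qfin: "emeasure lborel Q < \<infinity>" and q: "0 < measure lborel Q"
    using av by (auto simp: averageable_def)
  define q where "q = measure lborel Q"
  have q0: "0 < q" using q by (simp add: q_def)
  have eQ: "emeasure lborel Q = ennreal q" using Qfin unfolding q_def
    by (intro emeasure_eq_ennreal_measure) auto
  define P where "P = (\<integral>\<^sup>+x\<in>Q. (if 0 < w x then ennreal (max 0 (- ln (w x))) else \<infinity>) \<partial>lborel)"
  define N where "N = (\<integral>\<^sup>+x\<in>Q. ennreal (if 0 < w x then max 0 (ln (w x)) else 0) \<partial>lborel)"
  define G where "G = (\<integral>\<^sup>+x\<in>Q. log_gauge (w x / a) \<partial>lborel)"
  have XG: "X = G / ennreal q" by (simp add: X_def avg_def G_def q_def)
  have mass: "(\<integral>\<^sup>+x\<in>Q. ennreal (w x) \<partial>lborel) = ennreal (a * q)"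
  proof -
    have "(\<integral>\<^sup>+x\<in>Q. ennreal (w x) \<partial>lborel) / ennreal q * ennreal q = ennreal (a * q)"
      using a q0 by (simp add: avg_def q_def[symmetric] ennreal_mult)
    then show ?thesis using q0 by (simp add: ennreal_divide_times ennreal_divide_self)
  qed
  \<comment> \<open>Since \<open>ln w \<le> w\<close>, the positive part of \<open>ln w\<close> is
    integrable, so only \<open>P\<close> can be infinite.\<close>
  have "N \<le> (\<integral>\<^sup>+x\<in>Q. ennreal (w x) \<partial>lborel)"
    unfolding N_def
  proof (intro nn_integral_mono mult_right_mono ennreal_leI)
    fix x show "(if 0 < w x then max 0 (ln (w x)) else 0) \<le> w x"
      using w0[of x] ln_le_minus_one[of "w x"] by auto
  qed auto
  then have Nfin: "N < \<infinity>" using mass by (simp add: order.strict_trans1)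
  have Ap: "Ap_on \<infinity> w Q = ennreal a * exp_avg_log_inv Q w" using a by (simp add: Ap_on_def)
  have exp_eq: "exp_avg_log_inv Q w = (if P = \<infinity> then \<infinity> else ennreal (exp ((enn2real P - enn2real N) / q)))"
    using Nfin unfolding exp_avg_log_inv_def P_def[symmetric] N_def[symmetric] Let_def q_def by auto
  show ?thesis
  proof (cases "P = \<infinity>")
    case True
    \<comment> \<open>An infinite \<open>P\<close> forces an infinite gauge mean: the negative part
      of \<open>ln w\<close> exceeds the gauge by at most a constant depending on \<open>a\<close>,
      and \<open>Q\<close> has finite measure.\<close>
    have "P \<le> (\<integral>\<^sup>+x. log_gauge (w x / a) * indicator Q x + ennreal (1 + \<bar>ln a\<bar>) * indicator Q x \<partial>lborel)"
      unfolding P_def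
    proof (rule nn_integral_mono)
      fix x
      have "(if 0 < w x then ennreal (max 0 (- ln (w x))) else \<infinity>) \<le> log_gauge (w x / a) + ennreal (1 + \<bar>ln a\<bar>)"
      proof (cases "0 < w x")
        case True
        have ln: "ln (w x / a) = ln (w x) - ln a" using True a by (simp add: ln_div)
        have pos: "0 \<le> w x / a - ln (w x / a) - 1" using ln_le_minus_one[of "w x / a"] True a by simp
        have "max 0 (- ln (w x)) \<le> (w x / a - ln (w x / a) - 1) + (1 + \<bar>ln a\<bar>)"
          using pos True a unfolding ln by (smt (verit) divide_pos_pos)
        then show ?thesis using True pos a
          by (simp add: log_gauge_def ennreal_plus[symmetric] ennreal_leI del: ennreal_plus)
      next
        case False
        then show ?thesis using w0[of x] by (simp add: log_gauge_def)
      qed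
      then show "(if 0 < w x then ennreal (max 0 (- ln (w x))) else \<infinity>) * indicator Q x
          \<le> log_gauge (w x / a) * indicator Q x + ennreal (1 + \<bar>ln a\<bar>) * indicator Q x"
        by (auto split: split_indicator)
    qed
    also have "\<dots> = G + ennreal (1 + \<bar>ln a\<bar>) * ennreal q"
      by (simp add: nn_integral_add nn_integral_cmult G_def eQ)
    finally have "G = \<infinity>" using True
      by (simp add: top_unique ennreal_mult[symmetric] ennreal_add_eq_top del: ennreal_plus)
        (metis add_top ennreal_add_eq_top ennreal_mult_eq_top_iff ennreal_neq_top)
    then have "X = \<infinity>" by (simp add: XG ennreal_top_divide)
    then show ?thesis using True a by (simp add: Ap exp_eq ennreal_mult_top)
  next
    case False
    have wpos: "AE x in lborel. x \<in> Q \<longrightarrow> 0 < w x"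
    proof -
      have "AE x in lborel. (if 0 < w x then ennreal (max 0 (- ln (w x))) else \<infinity>) * indicator Q x \<noteq> \<infinity>"
        using False by (intro nn_integral_PInf_AE) (auto simp: P_def)
      then show ?thesis by eventually_elim (auto split: if_splits)
    qed
    define h1 where "h1 x = indicator Q x * max 0 (- ln (w x))" for x
    define h2 where "h2 x = indicator Q x * (if 0 < w x then max 0 (ln (w x)) else 0)" for x
    define h3 where "h3 x = indicator Q x * w x" for x
    have [measurable]: "h1 \<in> borel_measurable borel" "h2 \<in> borel_measurable borel" "h3 \<in> borel_measurable borel"
      unfolding h1_def h2_def h3_def by measurable
    have h0: "0 \<le> h1 x" "0 \<le> h2 x" "0 \<le> h3 x" for x using w0[of x] by (auto simp: h1_def h2_def h3_def)
    have n1: "(\<integral>\<^sup>+x. ennreal (h1 x) \<partial>lborel) = ennreal (enn2real P)"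
    proof -
      have "(\<integral>\<^sup>+x. ennreal (h1 x) \<partial>lborel) = P" unfolding P_def
        by (intro nn_integral_cong_AE) (use wpos in eventually_elim, auto simp: h1_def split: split_indicator)
      then show ?thesis using False by (simp add: less_top)
    qed
    have n2: "(\<integral>\<^sup>+x. ennreal (h2 x) \<partial>lborel) = ennreal (enn2real N)"
    proof -
      have "(\<integral>\<^sup>+x. ennreal (h2 x) \<partial>lborel) = N" unfolding N_def
        by (intro nn_integral_cong) (auto simp: h2_def split: split_indicator)
      then show ?thesis using Nfin by simp
    qed
    have n3: "(\<integral>\<^sup>+x. ennreal (h3 x) \<partial>lborel) = ennreal (a * q)"
      unfolding mass[symmetric] by (intro nn_integral_cong) (auto simp: h3_def split: split_indicator)
    have int: "has_bochner_integral lborel h1 (enn2real P)" "has_bochner_integral lborel h2 (enn2real N)"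
      "has_bochner_integral lborel h3 (a * q)"
      using h0 n1 n2 n3 a q0 by (auto intro!: has_bochner_integral_nn_integral)
    have int4: "has_bochner_integral lborel (indicator Q :: real \<Rightarrow> real) q"
      using Qfin unfolding q_def by (intro has_bochner_integral_real_indicator) auto
    \<comment> \<open>Almost everywhere on \<open>Q\<close> the difference \<open>h1 - h2\<close> is
      \<open>- ln w\<close>, so \<open>H\<close> is a real-valued copy of the gauge of
      \<open>w / a\<close> to which linearity of the Bochner integral applies.\<close>
    define H where "H x = h3 x / a + h1 x - h2 x + (ln a - 1) * indicator Q x" for x
    have intH: "has_bochner_integral lborel H (a * q / a + enn2real P - enn2real N + (ln a - 1) * q)"
      unfolding H_def
      by (intro has_bochner_integral_add has_bochner_integral_diff has_bochner_integral_divide_zero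
          has_bochner_integral_mult_right int int4)
    define Y where "Y = (enn2real P - enn2real N) / q + ln a"
    have Yq: "a * q / a + enn2real P - enn2real N + (ln a - 1) * q = Y * q"
      using a q0 by (simp add: Y_def field_simps)
    have Hx: "AE x in lborel. 0 \<le> H x \<and> log_gauge (w x / a) * indicator Q x = ennreal (H x)"
      using wpos
    proof eventually_elim
      case (elim x)
      show ?case
      proof (cases "x \<in> Q")
        case True
        then have wx: "0 < w x" using elim by simp
        have ln: "ln (w x / a) = ln (w x) - ln a" using wx a by (simp add: ln_div)
        have "H x = w x / a - ln (w x / a) - 1"
          using True wx by (simp add: H_def h1_def h2_def h3_def ln max_def)
        then show ?thesis using True wx a ln_le_minus_one[of "w x / a"] by (simp add: log_gauge_def)
      qed (simp add: H_def h1_def h2_def h3_def)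
    qed
    have "0 \<le> integral\<^sup>L lborel H" using Hx by (intro integral_nonneg_AE) auto
    then have Y0: "0 \<le> Y" using intH Yq q0
      by (simp add: has_bochner_integral_integral_eq zero_le_mult_iff)
    have "G = (\<integral>\<^sup>+x. ennreal (H x) \<partial>lborel)"
      unfolding G_def using Hx by (intro nn_integral_cong_AE) auto
    also have "\<dots> = ennreal (integral\<^sup>L lborel H)"
      using Hx intH by (intro nn_integral_eq_integral) (auto simp: has_bochner_integral_iff)
    finally have "G = ennreal (Y * q)" using intH Yq by (simp add: has_bochner_integral_integral_eq)
    then have X: "X = ennreal Y" using q0 Y0 by (simp add: XG divide_ennreal)
    have "ennreal a * ennreal (exp ((enn2real P - enn2real N) / q)) = ennreal (exp Y)"
      using a by (simp add: Y_def exp_add ennreal_mult[symmetric] mult.commute)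
    then show ?thesis using False X Y0 by (simp add: Ap exp_eq)
  qed
qed

section \<open>Threshold gauges for A_1 and RH_\<infinity>\<close>

definition low_gauge :: "real \<Rightarrow> real \<Rightarrow> ennreal" where
  "low_gauge k u = (if u < k then \<infinity> else 0)"

definition high_gauge :: "real \<Rightarrow> real \<Rightarrow> ennreal" where
  "high_gauge k u = (if k < u then \<infinity> else 0)"

lemma gauge_measurable [measurable]:
  "low_gauge k \<in> borel_measurable borel" "high_gauge k \<in> borel_measurable borel"
  unfolding low_gauge_def high_gauge_def by measurable

text \<open>At a point \<open>v < k\<close> the gauge is infinite, and any finite value there is
  reached by a sufficiently steep decreasing line vanishing at \<open>k\<close>; from
  \<open>k\<close> on this line is not positive.\<close>

lemma sup_of_affine_low_gauge: "sup_of_affine (low_gauge k)"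
  unfolding sup_of_affine_def
proof (intro allI impI)
  fix v y assume "0 < (v::real)" and y: "y < low_gauge k v"
  then have v: "v < k" by (auto simp: low_gauge_def split: if_splits)
  obtain r where r: "0 \<le> r" "y = ennreal r" using y by (cases y) auto
  define B where "B = r / (k - v)"
  have B: "0 \<le> B" "B * k + (- B) * v = r" using r v by (simp_all add: B_def diff_divide_distrib[symmetric] right_diff_distrib[symmetric])
  have "B * k + (- B) * u \<le> 0" if "k \<le> u" for u using B(1) that by (simp add: mult_left_mono)
  then show "\<exists>c d. y \<le> ennreal (c + d * v) \<and> (\<forall>u\<ge>0. ennreal (c + d * u) \<le> low_gauge k u)"
    using B r by (intro exI[of _ "B * k"] exI[of _ "- B"]) (auto simp: low_gauge_def ennreal_neg)
qed

lemma sup_of_affine_high_gauge: "sup_of_affine (high_gauge k)"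
  unfolding sup_of_affine_def
proof (intro allI impI)
  fix v y assume "0 < (v::real)" and y: "y < high_gauge k v"
  then have v: "k < v" by (auto simp: high_gauge_def split: if_splits)
  obtain r where r: "0 \<le> r" "y = ennreal r" using y by (cases y) auto
  define B where "B = r / (v - k)"
  have B: "0 \<le> B" "- B * k + B * v = r" using r v by (simp_all add: B_def diff_divide_distrib[symmetric] right_diff_distrib[symmetric])
  have "- B * k + B * u \<le> 0" if "u \<le> k" for u using B(1) that by (simp add: mult_left_mono)
  then show "\<exists>c d. y \<le> ennreal (c + d * v) \<and> (\<forall>u\<ge>0. ennreal (c + d * u) \<le> high_gauge k u)"
    using B r by (intro exI[of _ "- B * k"] exI[of _ B]) (auto simp: high_gauge_def ennreal_neg)
qed

text \<open>The integrand takes only the values 0 and infinity, so every finite bound on its mean,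
  whatever \<open>M\<close>, amounts to vanishing almost everywhere on \<open>Q\<close>.\<close>

lemma avg_infinite_indicator_le_iff:
  assumes "averageable w Q" and [measurable]: "Measurable.pred borel R"
  shows "avg Q (\<lambda>x. if R x then \<infinity> else 0) \<le> ennreal M \<longleftrightarrow> (AE x in lborel. x \<in> Q \<longrightarrow> \<not> R x)"
proof -
  have [measurable]: "Q \<in> sets borel" and q: "0 < measure lborel Q"
    using assms by (auto simp: averageable_def)
  let ?f = "\<lambda>x. (if R x then \<infinity> else 0) * indicator Q x :: ennreal"
  show ?thesis unfolding avg_le_iff[OF q]
  proof
    assume "integral\<^sup>N lborel ?f \<le> ennreal M * ennreal (measure lborel Q)"
    also have "\<dots> < \<infinity>" by (simp add: ennreal_mult_less_top)
    finally have "AE x in lborel. ?f x \<noteq> \<infinity>" by (intro nn_integral_PInf_AE) auto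
    then show "AE x in lborel. x \<in> Q \<longrightarrow> \<not> R x"
      by eventually_elim auto
  next
    assume "AE x in lborel. x \<in> Q \<longrightarrow> \<not> R x"
    then have "integral\<^sup>N lborel ?f = (\<integral>\<^sup>+x. 0 \<partial>(lborel :: real measure))"
      by (intro nn_integral_cong_AE) (auto elim!: eventually_mono split: split_indicator)
    then show "integral\<^sup>N lborel ?f \<le> ennreal M * ennreal (measure lborel Q)" by simp
  qed
qed

text \<open>The factor 2 makes room for a strict inequality: some admissible \<open>c\<close> in the
  supremum defining \<open>ess_inf_on\<close> exceeds \<open>a / (2 * V)\<close>, and attainment of
  the supremum does not have to be shown.\<close>

lemma low_gauge_of_A1_on:
  assumes av: "averageable w Q" and le: "Ap_on 1 w Q \<le> ennreal V" and V: "1 \<le> V"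
  shows "normalized_mean_le (low_gauge (1 / (2 * V))) 0 w Q"
  unfolding normalized_mean_le_def
proof
  assume "avg Q (\<lambda>x. ennreal (w x)) \<noteq> 0"
  then obtain a where a: "0 < a" "avg Q (\<lambda>x. ennreal (w x)) = ennreal a"
    using averageable_avg_cases[OF av] by metis
  have [measurable]: "w \<in> borel_measurable borel" and w0: "\<And>x. 0 \<le> w x" using av by (auto simp: averageable_def)
  have le': "ennreal a / ess_inf_on Q w \<le> ennreal V" using le a by (simp add: Ap_on_def)
  have "ennreal (a / (2 * V)) < ess_inf_on Q w"
  proof (cases "ess_inf_on Q w")
    case (real e)
    \<comment> \<open>A zero essential infimum would make the quotient infinite, since
      \<open>a\<close> is positive.\<close>
    have "e \<noteq> 0" using le' real a by (auto simp: top_unique)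
    then have e: "0 < e" using real by simp
    then have "a / e \<le> V" using le' real a V by (simp add: divide_ennreal)
    then have "a \<le> V * e" using e by (simp add: field_simps)
    also have "\<dots> < 2 * V * e" using V e by simp
    finally have "a / (2 * V) < e" using V by (simp add: field_simps)
    then show ?thesis using real a V by (simp add: ennreal_less_iff)
  qed simp
  then obtain c where c: "ennreal (a / (2 * V)) < c" "AE x in lborel. x \<in> Q \<longrightarrow> c \<le> ennreal (w x)"
    unfolding ess_inf_on_def less_Sup_iff by auto
  have "AE x in lborel. x \<in> Q \<longrightarrow> \<not> w x / a < 1 / (2 * V)"
    using c(2)
  proof eventually_elim
    case (elim x)
    show ?case
    proof
      assume "x \<in> Q"
      then have "ennreal (a / (2 * V)) \<le> ennreal (w x)" using elim c(1) by auto
      then have "a / (2 * V) \<le> w x" using w0 by simp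
      then show "\<not> w x / a < 1 / (2 * V)" using a V by (simp add: field_simps)
    qed
  qed
  then have "avg Q (\<lambda>x. low_gauge (1 / (2 * V)) (w x / a)) \<le> ennreal 0"
    unfolding low_gauge_def by (subst avg_infinite_indicator_le_iff[OF av]) auto
  then show "avg Q (\<lambda>x. low_gauge (1 / (2 * V)) (w x / enn2real (avg Q (\<lambda>x. ennreal (w x))))) \<le> ennreal 0"
    using a by simp
qed

lemma A1_on_of_low_gauge:
  assumes av: "averageable w Q" and le: "normalized_mean_le (low_gauge k) M w Q" and k: "0 < k"
  shows "Ap_on 1 w Q \<le> ennreal (1 / k)"
proof (rule averageable_avg_cases[OF av])
  assume "avg Q (\<lambda>x. ennreal (w x)) = 0"
  then show ?thesis by (simp add: Ap_on_def)
next
  fix a assume a: "0 < a" "avg Q (\<lambda>x. ennreal (w x)) = ennreal a"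
  have [measurable]: "w \<in> borel_measurable borel" and w0: "\<And>x. 0 \<le> w x" using av by (auto simp: averageable_def)
  have "avg Q (\<lambda>x. low_gauge k (w x / a)) \<le> ennreal M"
    using le a by (simp add: normalized_mean_le_def)
  then have "AE x in lborel. x \<in> Q \<longrightarrow> \<not> w x / a < k"
    unfolding low_gauge_def by (subst (asm) avg_infinite_indicator_le_iff[OF av]) auto
  then have "AE x in lborel. x \<in> Q \<longrightarrow> ennreal (a * k) \<le> ennreal (w x)"
    by eventually_elim (use a in \<open>auto simp: field_simps intro!: ennreal_leI\<close>)
  then have ess: "ennreal (a * k) \<le> ess_inf_on Q w" unfolding ess_inf_on_def by (intro Sup_upper) simp
  have "ennreal a / ess_inf_on Q w \<le> ennreal (1 / k)"
  proof (cases "ess_inf_on Q w")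
    case (real e)
    then have "a * k \<le> e" using ess by simp
    moreover have "0 < a * k" using a k by simp
    ultimately have "0 < e" "a / e \<le> 1 / k" using k by (auto simp: field_simps)
    then show ?thesis using real a by (simp add: divide_ennreal ennreal_leI)
  qed simp
  then show ?thesis using a by (simp add: Ap_on_def)
qed

text \<open>The factor 2 again buys strictness, here for an admissible \<open>c\<close> below
  \<open>2 * V * a\<close> in the infimum defining \<open>ess_sup_on\<close>.\<close>

lemma high_gauge_of_RH_infinity_on:
  assumes av: "averageable w Q" and le: "RH_on \<infinity> w Q \<le> ennreal V" and V: "1 \<le> V"
  shows "normalized_mean_le (high_gauge (2 * V)) 0 w Q"
  unfolding normalized_mean_le_def
proof
  assume "avg Q (\<lambda>x. ennreal (w x)) \<noteq> 0"
  then obtain a where a: "0 < a" "avg Q (\<lambda>x. ennreal (w x)) = ennreal a"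
    using averageable_avg_cases[OF av] by metis
  have [measurable]: "w \<in> borel_measurable borel" and w0: "\<And>x. 0 \<le> w x" using av by (auto simp: averageable_def)
  have le': "ess_sup_on Q w / ennreal a \<le> ennreal V" using le a by (simp add: RH_on_def)
  have "ess_sup_on Q w < ennreal (2 * V * a)"
  proof (cases "ess_sup_on Q w")
    case (real e)
    then have "e / a \<le> V" using le' a V by (simp add: divide_ennreal)
    then have "e \<le> V * a" using a by (simp add: field_simps)
    also have "\<dots> < 2 * V * a" using V a by simp
    finally show ?thesis using real by (simp add: ennreal_less_iff)
  next
    case top
    then show ?thesis using le' a by (simp add: ennreal_top_divide top_unique)
  qed
  then obtain c where c: "c < ennreal (2 * V * a)" "AE x in lborel. x \<in> Q \<longrightarrow> ennreal (w x) \<le> c"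
    unfolding ess_sup_on_def Inf_less_iff by auto
  have "AE x in lborel. x \<in> Q \<longrightarrow> \<not> 2 * V < w x / a"
    using c(2)
  proof eventually_elim
    case (elim x)
    show ?case
    proof
      assume "x \<in> Q"
      then have "ennreal (w x) \<le> ennreal (2 * V * a)" using elim c(1) by auto
      then have "w x \<le> 2 * V * a" using a V by (simp add: ennreal_le_iff)
      then show "\<not> 2 * V < w x / a" using a V by (simp add: field_simps)
    qed
  qed
  then have "avg Q (\<lambda>x. high_gauge (2 * V) (w x / a)) \<le> ennreal 0"
    unfolding high_gauge_def by (subst avg_infinite_indicator_le_iff[OF av]) auto
  then show "avg Q (\<lambda>x. high_gauge (2 * V) (w x / enn2real (avg Q (\<lambda>x. ennreal (w x))))) \<le> ennreal 0"
    using a by simp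
qed

lemma RH_infinity_on_of_high_gauge:
  assumes av: "averageable w Q" and le: "normalized_mean_le (high_gauge k) M w Q" and k: "0 < k"
  shows "RH_on \<infinity> w Q \<le> ennreal k"
proof (rule averageable_avg_cases[OF av])
  assume z: "avg Q (\<lambda>x. ennreal (w x)) = 0"
  \<comment> \<open>The functional becomes 0 / 0, which is 0 in \<open>ennreal\<close>.\<close>
  have "AE x in lborel. x \<in> Q \<longrightarrow> ennreal (w x) \<le> 0"
    using AE_zero_of_avg_eq_0[OF av z] by eventually_elim auto
  then have "ess_sup_on Q w \<le> 0" unfolding ess_sup_on_def by (intro Inf_lower) simp
  then show ?thesis by (simp add: RH_on_def z)
next
  fix a assume a: "0 < a" "avg Q (\<lambda>x. ennreal (w x)) = ennreal a"
  have [measurable]: "w \<in> borel_measurable borel" and w0: "\<And>x. 0 \<le> w x" using av by (auto simp: averageable_def)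
  have "avg Q (\<lambda>x. high_gauge k (w x / a)) \<le> ennreal M"
    using le a by (simp add: normalized_mean_le_def)
  then have "AE x in lborel. x \<in> Q \<longrightarrow> \<not> k < w x / a"
    unfolding high_gauge_def by (subst (asm) avg_infinite_indicator_le_iff[OF av]) auto
  then have "AE x in lborel. x \<in> Q \<longrightarrow> ennreal (w x) \<le> ennreal (k * a)"
    by eventually_elim (use a in \<open>auto simp: field_simps intro!: ennreal_leI\<close>)
  then have "ess_sup_on Q w \<le> ennreal (k * a)" unfolding ess_sup_on_def by (intro Inf_lower) simp
  then have "ess_sup_on Q w / ennreal a \<le> ennreal (k * a) / ennreal a" by (rule divide_right_mono_ennreal)
  also have "\<dots> = ennreal k" using a k by (simp add: divide_ennreal)
  finally show ?thesis using a by (simp add: RH_on_def)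
qed

section \<open>Scaling and conclusion\<close>

lemma dual_pow_scale:
  assumes p: "1 < p" and L: "1 \<le> L" and u: "0 \<le> u" and s: "1 / L \<le> s"
  shows "dual_pow p (\<lambda>u. u) (u * s) \<le> ennreal (L powr (1 / (p - 1))) * (dual_pow p (\<lambda>u. u) u + ennreal u + 1)"
proof (cases "u = 0")
  case True
  then show ?thesis using L by (simp add: dual_pow_def ennreal_mult_top)
next
  case False
  have s0: "0 < s" using s L by (smt (verit) divide_pos_pos)
  define r where "r = 1 / (p - 1)"
  have r: "0 < r" "- 1 / (p - 1) = - r" using p by (auto simp: r_def)
  have "s powr (- r) \<le> (1 / L) powr (- r)" using r s L by (intro powr_mono2') auto
  also have "\<dots> = L powr r" using L by (simp add: powr_divide powr_minus_divide)
  finally have "u powr (- r) * s powr (- r) \<le> u powr (- r) * L powr r" by (intro mult_left_mono) auto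
  then have "(u * s) powr (- r) \<le> L powr r * u powr (- r)" using u s0 by (simp add: powr_mult mult.commute)
  then have "dual_pow p (\<lambda>u. u) (u * s) \<le> ennreal (L powr r) * dual_pow p (\<lambda>u. u) u"
    using False s0 unfolding dual_pow_def r(2) by (simp add: ennreal_mult[symmetric] ennreal_leI)
  also have "\<dots> \<le> ennreal (L powr r) * (dual_pow p (\<lambda>u. u) u + ennreal u + 1)"
    by (intro mult_left_mono) (simp_all add: add.assoc)
  finally show ?thesis by (simp add: r_def)
qed

lemma powr_scale:
  assumes p: "1 < p" and u: "0 \<le> u" and s: "0 \<le> s" "s \<le> L"
  shows "ennreal ((u * s) powr p) \<le> ennreal (L powr p) * (ennreal (u powr p) + ennreal u + 1)"
proof -
  have "(u * s) powr p \<le> L powr p * u powr p"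
    using u s p by (simp add: powr_mult mult.commute mult_right_mono powr_mono2)
  then have "ennreal ((u * s) powr p) \<le> ennreal (L powr p) * ennreal (u powr p)"
    by (simp add: ennreal_mult[symmetric] ennreal_leI)
  also have "\<dots> \<le> ennreal (L powr p) * (ennreal (u powr p) + ennreal u + 1)"
    by (intro mult_left_mono) (simp_all add: add.assoc)
  finally show ?thesis .
qed

text \<open>Unlike the powers, this gauge is not homogeneous: rescaling adds a multiple of
  \<open>u\<close> and a constant coming from \<open>- ln s\<close>. These account for the two extra
  terms on the right.\<close>

lemma log_gauge_scale:
  assumes L: "1 \<le> L" and u: "0 \<le> u" and s: "1 / L \<le> s" "s \<le> L"
  shows "log_gauge (u * s) \<le> ennreal L * (log_gauge u + ennreal u + 1)"
proof (cases "u = 0")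
  case True
  then show ?thesis using L by (simp add: log_gauge_def ennreal_mult_top)
next
  case False
  then have u: "0 < u" using u by simp
  have s0: "0 < s" using s L by (smt (verit) divide_pos_pos)
  have g: "0 \<le> u - ln u - 1" using ln_le_minus_one[OF u] by simp
  have us: "u * s \<le> L * u" using u s by (simp add: mult.commute mult_left_mono)
  have "ln (1 / L) \<le> ln s" using s L by (subst ln_le_cancel_iff) (auto simp: s0)
  then have "- ln s \<le> ln L" using L by (simp add: ln_div)
  also have "\<dots> \<le> L" using L ln_le_minus_one[of L] by simp
  finally have "u * s - ln (u * s) - 1 \<le> (u - ln u - 1) + L * u + L"
    using us u ln_mult_pos[OF u s0] by linarith
  also have "\<dots> \<le> L * (u - ln u - 1) + L * u + L"
    using mult_right_mono[OF L g] by simp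
  finally have "u * s - ln (u * s) - 1 \<le> L * ((u - ln u - 1) + u + 1)"
    by (simp add: algebra_simps)
  then have "log_gauge (u * s) \<le> ennreal (L * ((u - ln u - 1) + u + 1))"
    using u s0 by (simp add: log_gauge_def ennreal_leI)
  also have "\<dots> = ennreal L * (log_gauge u + ennreal u + 1)"
  proof -
    have "log_gauge u + ennreal u + 1 = ennreal ((u - ln u - 1) + u + 1)"
      using u g by (simp add: log_gauge_def ennreal_plus[symmetric] del: ennreal_plus flip: ennreal_1)
    then show ?thesis using L by (simp add: ennreal_mult')
  qed
  finally show ?thesis .
qed

text \<open>A gauge with values 0 and infinity cannot record a loss in a multiplicative constant, so
  the threshold takes it, dropping from \<open>k\<close> to \<open>k / L\<close>.\<close>

lemma low_gauge_scale:
  assumes L: "1 \<le> L" and k: "0 \<le> k" and u: "0 \<le> u" and s: "1 / L \<le> s"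
  shows "low_gauge (k / L) (u * s) \<le> ennreal 1 * (low_gauge k u + ennreal u + 1)"
proof (cases "u < k")
  case False
  then have "k * (1 / L) \<le> u * s" using k L s u by (intro mult_mono) auto
  then show ?thesis by (simp add: low_gauge_def)
qed (simp add: low_gauge_def)

lemma high_gauge_scale:
  assumes L: "1 \<le> L" and u: "0 \<le> u" and s: "0 \<le> s" "s \<le> L"
  shows "high_gauge (k * L) (u * s) \<le> ennreal 1 * (high_gauge k u + ennreal u + 1)"
proof (cases "k < u")
  case False
  then have "u * s \<le> k * L" using L s u by (intro mult_mono) auto
  then show ?thesis by (simp add: high_gauge_def)
qed (simp add: high_gauge_def)

lemma normalized_mean_leI:
  assumes "averageable w Q"
    and "\<And>a. 0 < a \<Longrightarrow> avg Q (\<lambda>x. ennreal (w x)) = ennreal a \<Longrightarrow> avg Q (\<lambda>x. \<Phi> (w x / a)) \<le> ennreal M"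
  shows "normalized_mean_le \<Phi> M w Q"
  by (rule averageable_avg_cases[OF assms(1)]) (auto simp: normalized_mean_le_def assms(2))

lemma normalized_mean_leD:
  assumes "normalized_mean_le \<Phi> M w Q" "0 < a" "avg Q (\<lambda>x. ennreal (w x)) = ennreal a"
  shows "avg Q (\<lambda>x. \<Phi> (w x / a)) \<le> ennreal M"
  using assms by (simp add: normalized_mean_le_def)

section \<open>The bounds for A_p and RH_p\<close>

lemma trans_avg_Ap:
  assumes p: "1 \<le> (p::ereal)"
  shows "\<exists>K::real. \<forall>om :: real \<Rightarrow> real \<Rightarrow> real.
        (\<lambda>(t, x). om t x) \<in> borel_measurable borel \<and>
        (\<forall>t\<in>{0..1}. weight (om t) \<and> doubling Cdbl (om t) \<and> (SUP I\<in>dyadics. Ap_on p (om t) I) \<le> ennreal V) \<and>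
        (\<integral>\<^sup>+x\<in>{0..1}. (\<integral>\<^sup>+t\<in>{0..1}. ennreal (om t (x + t)) \<partial>lborel) \<partial>lborel) < \<infinity>
        \<longrightarrow> (SUP Q\<in>arcs. Ap_on p (trans_avg om) Q) \<le> ennreal K"
proof -
  \<comment> \<open>Raising both constants to at least 1 only weakens the assumptions; it makes
    \<open>2 * C^3\<close> at least 1 and \<open>ln W\<close> nonnegative.\<close>
  define C where "C = max 1 Cdbl"
  define W where "W = max 1 V"
  have C: "1 \<le> C" "Cdbl \<le> C" and W: "1 \<le> W" "ennreal V \<le> ennreal W"
    by (auto simp: C_def W_def intro: ennreal_leI)
  have L: "1 \<le> 2 * C^3" using one_le_power[OF C(1), of 3] by simp
  consider "p = 1" | "p = \<infinity>" | r where "p = ereal r" "1 < r"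
    using p by (cases p) (auto simp: one_ereal_def order_le_less)
  then show ?thesis
  proof cases
    case 1
    \<comment> \<open>The dyadic bound gives the threshold \<open>1 / (2 * W)\<close>, which
      rescaling lowers by \<open>2 * C^3\<close>; the reciprocal \<open>4 * W * C^3\<close> is the
      final constant.\<close>
    have k: "0 < 1 / (2 * W) / (2 * C^3)" using W C by simp
    show ?thesis unfolding 1
    proof (rule trans_avg_functional_bound[OF gauge_measurable(1) gauge_measurable(1)
          sup_of_affine_low_gauge order.refl zero_le_one C])
      show "low_gauge (1 / (2 * W) / (2 * C^3)) (u * s) \<le> ennreal 1 * (low_gauge (1 / (2 * W)) u + ennreal u + 1)"
        if "0 \<le> u" "1 / (2 * C^3) \<le> s" for u s
        by (rule low_gauge_scale) (use that W L in auto)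
      show "normalized_mean_le (low_gauge (1 / (2 * W))) 0 w Q" if "averageable w Q" "Ap_on 1 w Q \<le> ennreal V" for w Q
        using that W by (intro low_gauge_of_A1_on) (auto intro: order.trans)
      show "Ap_on 1 w Q \<le> ennreal (1 / (1 / (2 * W) / (2 * C^3)))"
        if "averageable w Q" "normalized_mean_le (low_gauge (1 / (2 * W) / (2 * C^3))) (4 * 1 * (0 + 2)) w Q" for w Q
        by (rule A1_on_of_low_gauge[OF that k])
    qed
  next
    case 2
    have lnW: "0 \<le> ln W" using W by simp
    have L0: "0 \<le> 2 * C^3" using C by simp
    \<comment> \<open>A dyadic constant \<open>W\<close> means a gauge mean of at most
      \<open>ln W\<close>; passing to arcs turns this into \<open>?M\<close>, and the final constant
      is \<open>exp ?M\<close>.\<close>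
    let ?M = "4 * (2 * C^3) * (ln W + 2)"
    show ?thesis unfolding 2
    proof (rule trans_avg_functional_bound[OF log_gauge_measurable log_gauge_measurable
          sup_of_affine_log_gauge lnW L0 C])
      show "log_gauge (u * s) \<le> ennreal (2 * C^3) * (log_gauge u + ennreal u + 1)"
        if "0 \<le> u" "1 / (2 * C^3) \<le> s" "s \<le> 2 * C^3" for u s
        by (rule log_gauge_scale[OF L that])
      show "normalized_mean_le log_gauge (ln W) w Q" if av: "averageable w Q" and le: "Ap_on \<infinity> w Q \<le> ennreal V" for w Q
      proof (rule normalized_mean_leI[OF av])
        fix a assume a: "0 < a" "avg Q (\<lambda>x. ennreal (w x)) = ennreal a"
        let ?X = "avg Q (\<lambda>x. log_gauge (w x / a))"
        have le': "Ap_on \<infinity> w Q \<le> ennreal W" using le W by (auto intro: order.trans)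
        then have X: "?X \<noteq> \<infinity>" "ennreal (exp (enn2real ?X)) \<le> ennreal W"
          unfolding Ap_on_infinity_eq_exp_normalized[OF av a] by (auto simp: top_unique split: if_splits)
        then have "exp (enn2real ?X) \<le> W" using W by (simp add: ennreal_le_iff)
        then have "enn2real ?X \<le> ln W" using W by (simp add: ln_ge_iff)
        then show "?X \<le> ennreal (ln W)" using X(1)
          by (metis ennreal_enn2real ennreal_leI infinity_ennreal_def less_top)
      qed
      show "Ap_on \<infinity> w Q \<le> ennreal (exp ?M)"
        if av: "averageable w Q" and le: "normalized_mean_le log_gauge ?M w Q" for w Q
      proof (rule averageable_avg_cases[OF av])
        fix a assume a: "0 < a" "avg Q (\<lambda>x. ennreal (w x)) = ennreal a"
        let ?X = "avg Q (\<lambda>x. log_gauge (w x / a))"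
        have X: "?X \<le> ennreal ?M" by (rule normalized_mean_leD[OF le a])
        have "enn2real ?X \<le> ?M" using X L0 lnW by (intro enn2real_leI) auto
        moreover have "?X \<noteq> \<infinity>" using X by (auto simp: top_unique)
        ultimately show ?thesis
          unfolding Ap_on_infinity_eq_exp_normalized[OF av a] by (auto intro: ennreal_leI)
      qed (simp add: Ap_on_def)
    qed
  next
    case 3
    have r1: "0 < r - 1" using 3 by simp
    \<comment> \<open>\<open>?M\<close> is the dyadic bound with the outer power
      \<open>r - 1\<close> undone, and \<open>?N\<close> is the cost of rescaling by
      \<open>2 * C^3\<close>.\<close>
    let ?M = "W powr (1 / (r - 1))" and ?N = "(2 * C^3) powr (1 / (r - 1))"
    have M0: "0 \<le> ?M" and N0: "0 \<le> ?N" by auto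
    show ?thesis unfolding 3(1)
    proof (rule trans_avg_functional_bound[OF dual_pow_measurable dual_pow_measurable
          sup_of_affine_dual_pow[OF 3(2)] M0 N0 C])
      show "dual_pow r (\<lambda>u. u) (u * s) \<le> ennreal ?N * (dual_pow r (\<lambda>u. u) u + ennreal u + 1)"
        if "0 \<le> u" "1 / (2 * C^3) \<le> s" for u s
        by (rule dual_pow_scale[OF 3(2) L that])
      show "normalized_mean_le (dual_pow r (\<lambda>u. u)) ?M w Q"
        if av: "averageable w Q" and le: "Ap_on (ereal r) w Q \<le> ennreal V" for w Q
      proof (rule normalized_mean_leI[OF av])
        fix a assume a: "0 < a" "avg Q (\<lambda>x. ennreal (w x)) = ennreal a"
        show "avg Q (\<lambda>x. dual_pow r (\<lambda>u. u) (w x / a)) \<le> ennreal ?M"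
          using le W Ap_on_eq_epowr_normalized[OF av a 3(2)]
          by (intro le_of_epowr_le[OF r1]) (auto intro: order.trans)
      qed
      show "Ap_on (ereal r) w Q \<le> ennreal ((4 * ?N * (?M + 2)) powr (r - 1))"
        if av: "averageable w Q" and le: "normalized_mean_le (dual_pow r (\<lambda>u. u)) (4 * ?N * (?M + 2)) w Q" for w Q
      proof (rule averageable_avg_cases[OF av])
        assume "avg Q (\<lambda>x. ennreal (w x)) = 0"
        then show ?thesis using 3 by (simp add: Ap_on_def one_ereal_def)
      next
        fix a assume a: "0 < a" "avg Q (\<lambda>x. ennreal (w x)) = ennreal a"
        show ?thesis unfolding Ap_on_eq_epowr_normalized[OF av a 3(2)]
          by (rule epowr_le[OF r1 _ normalized_mean_leD[OF le a]]) simp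
      qed
    qed
  qed
qed

lemma trans_avg_RH:
  assumes p: "1 < (p::ereal)"
  shows "\<exists>K::real. \<forall>om :: real \<Rightarrow> real \<Rightarrow> real.
        (\<lambda>(t, x). om t x) \<in> borel_measurable borel \<and>
        (\<forall>t\<in>{0..1}. weight (om t) \<and> doubling Cdbl (om t) \<and> (SUP I\<in>dyadics. RH_on p (om t) I) \<le> ennreal V) \<and>
        (\<integral>\<^sup>+x\<in>{0..1}. (\<integral>\<^sup>+t\<in>{0..1}. ennreal (om t (x + t)) \<partial>lborel) \<partial>lborel) < \<infinity>
        \<longrightarrow> (SUP Q\<in>arcs. RH_on p (trans_avg om) Q) \<le> ennreal K"
proof -
  define C where "C = max 1 Cdbl"
  define W where "W = max 1 V"
  have C: "1 \<le> C" "Cdbl \<le> C" and W: "1 \<le> W" "ennreal V \<le> ennreal W"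
    by (auto simp: C_def W_def intro: ennreal_leI)
  have L: "1 \<le> 2 * C^3" using one_le_power[OF C(1), of 3] by simp
  have s0: "0 \<le> s" if "1 / (2 * C^3) \<le> s" for s :: real
    using that L by (smt (verit) divide_nonneg_pos)
  consider "p = \<infinity>" | r where "p = ereal r" "1 < r"
    using p by (cases p) (auto simp: one_ereal_def)
  then show ?thesis
  proof cases
    case 1
    have k: "0 < (2 * W) * (2 * C^3)" using W C by simp
    show ?thesis unfolding 1
    proof (rule trans_avg_functional_bound[OF gauge_measurable(2) gauge_measurable(2)
          sup_of_affine_high_gauge order.refl zero_le_one C])
      show "high_gauge ((2 * W) * (2 * C^3)) (u * s) \<le> ennreal 1 * (high_gauge (2 * W) u + ennreal u + 1)"
        if "0 \<le> u" "1 / (2 * C^3) \<le> s" "s \<le> 2 * C^3" for u s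
        by (rule high_gauge_scale[OF L that(1) s0[OF that(2)] that(3)])
      show "normalized_mean_le (high_gauge (2 * W)) 0 w Q" if "averageable w Q" "RH_on \<infinity> w Q \<le> ennreal V" for w Q
        using that W by (intro high_gauge_of_RH_infinity_on) (auto intro: order.trans)
      show "RH_on \<infinity> w Q \<le> ennreal ((2 * W) * (2 * C^3))"
        if "averageable w Q" "normalized_mean_le (high_gauge ((2 * W) * (2 * C^3))) (4 * 1 * (0 + 2)) w Q" for w Q
        by (rule RH_infinity_on_of_high_gauge[OF that k])
    qed
  next
    case 2
    have r1: "0 < 1 / r" "0 < r" using 2 by auto
    let ?M = "W powr r" and ?N = "(2 * C^3) powr r"
    have M0: "0 \<le> ?M" and N0: "0 \<le> ?N" by auto
    have meas: "(\<lambda>u. ennreal (u powr r)) \<in> borel_measurable borel" by measurable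
    show ?thesis unfolding 2(1)
    proof (rule trans_avg_functional_bound[OF meas meas sup_of_affine_powr[OF 2(2)] M0 N0 C])
      show "ennreal ((u * s) powr r) \<le> ennreal ?N * (ennreal (u powr r) + ennreal u + 1)"
        if "0 \<le> u" "1 / (2 * C^3) \<le> s" "s \<le> 2 * C^3" for u s
        by (rule powr_scale[OF 2(2) that(1) s0[OF that(2)] that(3)])
      show "normalized_mean_le (\<lambda>u. ennreal (u powr r)) ?M w Q"
        if av: "averageable w Q" and le: "RH_on (ereal r) w Q \<le> ennreal V" for w Q
      proof (rule normalized_mean_leI[OF av])
        fix a assume a: "0 < a" "avg Q (\<lambda>x. ennreal (w x)) = ennreal a"
        show "avg Q (\<lambda>x. ennreal ((w x / a) powr r)) \<le> ennreal ?M"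
          using le_of_epowr_le[OF r1(1), of W] order.trans[OF le W(2)] W(1)
          unfolding RH_on_eq_epowr_normalized[OF av a 2(2)] by simp
      qed
      show "RH_on (ereal r) w Q \<le> ennreal ((4 * ?N * (?M + 2)) powr (1 / r))"
        if av: "averageable w Q" and le: "normalized_mean_le (\<lambda>u. ennreal (u powr r)) (4 * ?N * (?M + 2)) w Q" for w Q
      proof (rule averageable_avg_cases[OF av])
        assume z: "avg Q (\<lambda>x. ennreal (w x)) = 0"
        \<comment> \<open>For zero mean \<open>w powr r\<close> vanishes almost everywhere together
          with \<open>w\<close>, and the functional is again 0 / 0, hence 0.\<close>
        have "(\<integral>\<^sup>+x\<in>Q. ennreal (w x powr r) \<partial>lborel) = (\<integral>\<^sup>+x. 0 \<partial>(lborel :: real measure))"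
          using AE_zero_of_avg_eq_0[OF av z]
          by (intro nn_integral_cong_AE) (auto elim!: eventually_mono split: split_indicator)
        then show ?thesis by (simp add: RH_on_def avg_def epowr_def)
      next
        fix a assume a: "0 < a" "avg Q (\<lambda>x. ennreal (w x)) = ennreal a"
        show ?thesis unfolding RH_on_eq_epowr_normalized[OF av a 2(2)]
          by (rule epowr_le[OF r1(1) _ normalized_mean_leD[OF le a]]) simp
      qed
    qed
  qed
qed

text \<open>Choosing \<open>K\<close> before \<open>om\<close> expresses that it depends on
  \<open>p\<close>, \<open>Cdbl\<close> and \<open>V\<close> alone. Finiteness of the double
  integral makes the average integrable over the circle; the A_p, RH_p and doubling bounds cannot
  supply this, being unchanged when \<open>om t\<close> is multiplied by a positive measurable
  function of \<open>t\<close>.\<close>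

theorem mainTheorem6:
  shows "(\<forall>(p::ereal) (Cdbl::real) (V::real). 1 \<le> p \<longrightarrow>
     (\<exists>K::real. \<forall>om :: real \<Rightarrow> real \<Rightarrow> real.
        (\<lambda>(t, x). om t x) \<in> borel_measurable borel \<and>
        (\<forall>t\<in>{0..1}. weight (om t) \<and> doubling Cdbl (om t) \<and> Apd_const p (om t) \<le> ennreal V) \<and>
        (\<integral>\<^sup>+x\<in>{0..1}. (\<integral>\<^sup>+t\<in>{0..1}. ennreal (om t (x + t)) \<partial>lborel) \<partial>lborel) < \<infinity>
        \<longrightarrow> Ap_const p (trans_avg om) \<le> ennreal K))
   \<and> (\<forall>(p::ereal) (Cdbl::real) (V::real). 1 < p \<longrightarrow>
     (\<exists>K::real. \<forall>om :: real \<Rightarrow> real \<Rightarrow> real.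
        (\<lambda>(t, x). om t x) \<in> borel_measurable borel \<and>
        (\<forall>t\<in>{0..1}. weight (om t) \<and> doubling Cdbl (om t) \<and> RHd_le p (om t) V) \<and>
        (\<integral>\<^sup>+x\<in>{0..1}. (\<integral>\<^sup>+t\<in>{0..1}. ennreal (om t (x + t)) \<partial>lborel) \<partial>lborel) < \<infinity>
        \<longrightarrow> RH_const p (trans_avg om) \<le> ennreal K))"
proof (intro conjI allI impI, goal_cases)
  case (1 p Cdbl V)
  then show ?case unfolding Apd_const_def Ap_const_def by (rule trans_avg_Ap)
next
  case (2 p Cdbl V)
  from trans_avg_RH[OF 2, of Cdbl V] show ?case
    unfolding RHd_le_def RH_const_def by blast
qed

end
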